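(* Let $\mathbb V$ be a $C_2$-cofinite and rational VOA with central charge $c$, and let $\mathbb W$ be a simple $\mathbb V$-module with conformal weight $\Delta_{\mathbb W}$. Let $\mathbb H$ be the upper half plane, $\mathcal B=\mathbb H\times\mathbb C^\times$ with standard coordinates $\tau,\zeta$, and let $\mathfrak X=(\pi:\mathcal C\to\mathcal B;\sigma)$ be the family of $1$-pointed elliptic curves with $\mathcal C=(\mathbb C\times\mathcal B)/\mathbb Z^2$, where $(a,b)\in\mathbb Z^2$ acts by $(z,\tau,\zeta)\mapsto(z+a+b\tau,\tau,\zeta)$, and $\sigma$ is induced by $(\tau,\zeta)\mapsto(0,\tau,\zeta)$. Let $\mathfrak P$ be the projective structure of $\mathfrak X$ whose lift to $\mathbb C\times\mathcal B$ contains the function $z$, and let $\mathfrak P'$ be the one whose lift contains (on open sets where it is injective on fibers) the function $\exp(2\mathbf i\pi z)$, where $\mathbf i=\sqrt{-1}$. Let $\nu$ and $\nu'$ be the jets of $\mathfrak X$ along $\sigma$ given by $\nu=\zeta\,dz$ and $\nu'=2\mathbf i\pi\,dz$. Then, when acting on sections of $\mathscr T^*_{\mathfrak X}(\mathbb W)$, $$\nabla^{\mathfrak P,\nu}_{\partial_\tau}=\nabla^{\mathfrak P',\nu'}_{\partial_\tau}+\frac{\mathbf i c\pi}{12}\,\mathrm{id},\qquad\nabla^{\mathfrak P,\nu}_{\partial_\zeta}=\nabla^{\mathfrak P',\nu'}_{\partial_\zeta}+\frac{\Delta_{\mathbb W}}{\zeta}\,\mathrm{id}.$$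
   Context: VOAs and modules. A VOA is a vertex operator algebra $\mathbb V=\bigoplus_{n\in\mathbb N}\mathbb V(n)$ over $\mathbb C$ with $\dim\mathbb V(n)<\infty$, $\dim\mathbb V(0)=1$, $Y(u,z)=\sum_nY(u)_nz^{-n-1}$, vacuum $\mathbf 1$, conformal vector $\mathbf c$, $L_n=Y(\mathbf c)_{n+1}$ with central charge $c$, $L_0=n$ on $\mathbb V(n)$; $\mathbb V^{\le n}=\bigoplus_{k\le n}\mathbb V(k)$, $\mathrm{wt}(v)=n$ on $\mathbb V(n)$. $C_2$-cofinite: the span of $\{Y(u)_{-2}v\}$ has finite codimension. A weak module $(\mathbb W,Y_{\mathbb W})$ satisfies lower truncation, $Y_{\mathbb W}(\mathbf 1,z)=\mathrm{id}$ and the Jacobi identity; $L_n=Y_{\mathbb W}(\mathbf c)_{n+1}$; it is admissible if $\mathbb N$-graded with $Y_{\mathbb W}(v)_m\mathbb W(n)\subset\mathbb W(n+\mathrm{wt}(v)-m-1)$; $\Omega(\mathbb W)=\{w:Y_{\mathbb W}(v)_nw=0,\ v$ homogeneous, $n\ge\mathrm{wt}(v)\}$. Rational: every admissible module generated by $\Omega(\mathbb W)$ with $\dim\Omega(\mathbb W)<\infty$ is completely reducible. A $\mathbb V$-module is a weak module on which $L_0$ is diagonalizable with finite-dimensional eigenspaces and eigenvalues in $E+\mathbb N$, $E$ finite. For simple $\mathbb W$, $\Delta_{\mathbb W}$ is the lowest $L_0$-eigenvalue and $\widetilde L_0=L_0-\Delta_{\mathbb W}$. Conformal blocks. For germs $\rho$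 at $0\in\mathbb C$ with $\rho(0)=0,\rho'(0)\ne0$, write $\rho(z)=\rho'(0)\exp(\sum_{n>0}c_nz^{n+1}\partial_z)z$, $\mathcal U(\rho)=\rho'(0)^{\widetilde L_0}\exp(\sum_{n>0}c_nL_n)$. For a family $\mathfrak X=(\pi:\mathcal C\to\mathcal B;\sigma)$ of $1$-pointed compact Riemann surfaces: $\mathscr V_{\mathfrak X}=\varinjlim_n\mathscr V_{\mathfrak X}^{\le n}$, with trivializations $\mathcal U_\varrho(\eta):\mathscr V_{\mathfrak X}^{\le n}|_U\simeq\mathbb V^{\le n}\otimes\mathcal O_U$ ($\eta\in\mathcal O(U)$ injective on fibers) and transition functions $\mathcal U(\varrho(\eta|\mu))$, $\varrho(\eta|\mu)_p(z)=\eta\circ(\mu,\pi)^{-1}(z+\mu(p),\pi(p))-\eta(p)$. A local coordinate $\eta$ at $\sigma$ is a holomorphic function near $\sigma(\mathcal B)$, zero on $\sigma(\mathcal B)$, injective on fibers. $\mathscr W_{\mathfrak X}(\mathbb W)$ has trivializations $\mathcal U(\eta):\mathscr W_{\mathfrak X}(\mathbb W)\simeq\mathbb W\otimes\mathcal O_{\mathcal B}$ with $\mathcal U(\eta)\mathcal U(\mu)^{-1}$ at $b$ equal to $\mathcal U((\eta|\mu)_b)$, $(\eta|\mu)_b(z)=\eta\circ(\mu,\pi)^{-1}(z,b)$. A section $v$ of $\pi_*(\mathscr V_{\mathfrak X}\otimes\omega_{\mathcal C/\mathcal B}(\bullet\sigma(\mathcal B)))$ (finite poles along $\sigma(\mathcal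 B)$) with $\mathcal U_\varrho(\eta)v=u(\eta,b)d\eta$ near $\sigma$ acts by $\mathrm{Res}_{z=0}Y_{\mathbb W}(u(z,b),z)dz$. $\mathscr T_{\mathfrak X}(\mathbb W)$ is the quotient of $\mathscr W_{\mathfrak X}(\mathbb W)$ by the submodule generated by all $v\cdot w$, and $\mathscr T^*_{\mathfrak X}(\mathbb W)$ is its dual. Connections. Let $\tau_\bullet$ be coordinates of $\mathcal B$ (over a small Stein open subset), $\eta$ a local coordinate at $\sigma$, $\mathfrak y=\sum_jg_j\partial_{\tau_j}$, and $\widetilde{\mathfrak y}\in H^0(\mathcal C,\Theta_{\mathcal C}(\bullet\sigma(\mathcal B)))$ a lift ($d\pi(\widetilde{\mathfrak y})=\pi^*\mathfrak y$), $\widetilde{\mathfrak y}=h(\eta,\tau_\bullet)\partial_\eta+\sum_jg_j\partial_{\tau_j}$ near $\sigma$ in the coordinates $(\eta,\tau_\bullet)$. Under $\mathcal U(\eta)$ put $\nabla^{(\eta)}_{\mathfrak y}w=\sum_jg_j\partial_{\tau_j}w-\mathrm{Res}_{z=0}h(z,\tau_\bullet)Y_{\mathbb W}(\mathbf c,z)w\,dz$; it descends to $\mathscr T_{\mathfrak X}(\mathbb W)$ and is defined on the dual by $\langle\nabla_{\mathfrak y}\phi,s\rangle=\mathfrak y\langle\phi,s\rangle-\langle\phi,\nabla_{\mathfrak y}s\rangle$. Schwarzian: $\mathbf S_\eta f=\frac{\partial_\eta^3f}{\partial_\eta f}-\frac32\big(\frac{\partial_\eta^2f}{\partial_\eta f}\big)^2$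 ($\partial_\eta$ along fibers). A projective structure is a maximal collection of pairs $(U,\mu)$, $U$ open covering $\mathcal C$, $\mu\in\mathcal O(U)$ injective on fibers, with $\mathbf S_{\mu_1}\mu_2=0$ on overlaps; $\mathbf S_\eta\mathfrak P:=\mathbf S_\eta\mu$ for $(U,\mu)\in\mathfrak P$. A jet is a nowhere zero section of $\sigma^*\omega_{\mathcal C/\mathcal B}$. For a projective structure $\mathfrak P$ and jet $\nu$, $$\nabla^{\mathfrak P,\nu}_{\mathfrak y}\phi=\nabla^{(\eta)}_{\mathfrak y}\phi-\Big(\mathrm{Res}_{\eta=0}\tfrac c{12}h(\eta,\tau_\bullet)\,\mathbf S_\eta\mathfrak P\,d\eta\Big)\phi-\Delta_{\mathbb W}\,\mathfrak y\Big(\log\frac{\sigma^*d\eta}{\nu}\Big)\phi,$$ which is independent of $\eta$ and of the lift. *)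

theory Defs
  imports
    "HOL-Complex_Analysis.Complex_Analysis"
    "HOL-Library.Groups_Big_Fun"
begin

section \<open>Linear algebra over the complex numbers\<close>

text \<open>
  A complex vector space is an abelian group together with a scalar multiplication
  \<open>sc\<close> satisfying \<^const>\<open>vector_space\<close>. All sums that are written as infinite sums in
  the theory of vertex algebras have finite support and are expressed by
  \<^const>\<open>Sum_any\<close> (which is \<open>0\<close> on functions of infinite support).
\<close>

definition lin_functional :: "(complex \<Rightarrow> 'w::ab_group_add \<Rightarrow> 'w) \<Rightarrow> ('w \<Rightarrow> complex) \<Rightarrow> bool" where
  "lin_functional sc l \<longleftrightarrow> Vector_Spaces.linear sc (*) l"

definition fin_dim :: "(complex \<Rightarrow> 'w::ab_group_add \<Rightarrow> 'w) \<Rightarrow> 'w set \<Rightarrow> bool" where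
  "fin_dim sc A \<longleftrightarrow> (\<exists>B. finite B \<and> A \<subseteq> module.span sc B)"

definition internal_direct_sum ::
    "(complex \<Rightarrow> 'w::ab_group_add \<Rightarrow> 'w) \<Rightarrow> 'i set \<Rightarrow> ('i \<Rightarrow> 'w set) \<Rightarrow> 'w set \<Rightarrow> bool" where
  "internal_direct_sum sc I A W \<longleftrightarrow>
     (\<forall>i\<in>I. module.subspace sc (A i) \<and> A i \<subseteq> W) \<and>
     (\<forall>w\<in>W. \<exists>!d. (\<forall>i\<in>I. d i \<in> A i) \<and> (\<forall>i. i \<notin> I \<longrightarrow> d i = 0) \<and>
                  finite {i. d i \<noteq> 0} \<and> w = Sum_any d)"

text \<open>
  Scalar operations \<open>T\<close> (residues, partial derivatives) applied to functions \<open>F\<close> that take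
  values in a finite-dimensional subspace of a vector space without topology:
  the result is the vector determined by all of its coordinates.
\<close>

definition vec_apply ::
    "(complex \<Rightarrow> 'w::ab_group_add \<Rightarrow> 'w) \<Rightarrow> (('a \<Rightarrow> complex) \<Rightarrow> complex) \<Rightarrow> ('a \<Rightarrow> 'w) \<Rightarrow> 'w" where
  "vec_apply sc T F = (THE x. \<forall>l. lin_functional sc l \<longrightarrow> l x = T (l \<circ> F))"


section \<open>Vertex operator algebras and their modules\<close>

text \<open>
  \<open>vop V u n v\<close> is \<open>Y(u)\<^sub>n v\<close>. The space of a VOA is the whole type; the space of a
  module is a subspace \<open>mcar\<close> of its ambient type, so that submodules are again of this form.
\<close>

record 'v voa =
  vscale :: "complex \<Rightarrow> 'v \<Rightarrow> 'v"
  vgrade :: "nat \<Rightarrow> 'v set"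
  vop :: "'v \<Rightarrow> int \<Rightarrow> 'v \<Rightarrow> 'v"
  vac :: 'v
  cvec :: 'v
  ccharge :: complex

record ('v, 'w) vmod =
  mcar :: "'w set"
  mscale :: "complex \<Rightarrow> 'w \<Rightarrow> 'w"
  mop :: "'v \<Rightarrow> int \<Rightarrow> 'w \<Rightarrow> 'w"

definition adjoint_mod :: "'v::ab_group_add voa \<Rightarrow> ('v, 'v) vmod" where
  "adjoint_mod V = \<lparr>mcar = UNIV, mscale = vscale V, mop = vop V\<rparr>"

definition Vir :: "'v::ab_group_add voa \<Rightarrow> ('v, 'w::ab_group_add) vmod \<Rightarrow> int \<Rightarrow> 'w \<Rightarrow> 'w" where
  "Vir V M n w = mop M (cvec V) (n + 1) w"

text \<open>The Jacobi identity, written in modes (Borcherds form).\<close>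

definition jacobi_identity :: "'v::ab_group_add voa \<Rightarrow> ('v, 'w::ab_group_add) vmod \<Rightarrow> bool" where
  "jacobi_identity V M \<longleftrightarrow>
     (\<forall>u v. \<forall>w\<in>mcar M. \<forall>m n k :: int.
        Sum_any (\<lambda>l::nat. mscale M (of_int m gchoose l)
           (mop M (vop V u (n + int l) v) (m + k - int l) w)) =
        Sum_any (\<lambda>l::nat. mscale M ((-1) ^ l * (of_int n gchoose l))
           (mop M u (m + n - int l) (mop M v (k + int l) w))) -
        Sum_any (\<lambda>l::nat. mscale M ((-1) powi (n + int l) * (of_int n gchoose l))
           (mop M v (n + k - int l) (mop M u (m + int l) w))))"

definition weak_module :: "'v::ab_group_add voa \<Rightarrow> ('v, 'w::ab_group_add) vmod \<Rightarrow> bool" where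
  "weak_module V M \<longleftrightarrow>
     vector_space (mscale M) \<and> module.subspace (mscale M) (mcar M) \<and>
     (\<forall>u n. \<forall>w\<in>mcar M. mop M u n w \<in> mcar M) \<and>
     (\<forall>u v n. \<forall>w\<in>mcar M. mop M (u + v) n w = mop M u n w + mop M v n w) \<and>
     (\<forall>a u n. \<forall>w\<in>mcar M. mop M (vscale V a u) n w = mscale M a (mop M u n w)) \<and>
     (\<forall>u n. \<forall>w\<in>mcar M. \<forall>w'\<in>mcar M. mop M u n (w + w') = mop M u n w + mop M u n w') \<and>
     (\<forall>a u n. \<forall>w\<in>mcar M. mop M u n (mscale M a w) = mscale M a (mop M u n w)) \<and>
     (\<forall>u. \<forall>w\<in>mcar M. \<exists>N. \<forall>n\<ge>N. mop M u n w = 0) \<and>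
     (\<forall>n. \<forall>w\<in>mcar M. mop M (vac V) n w = (if n = -1 then w else 0)) \<and>
     jacobi_identity V M"

definition voa :: "'v::ab_group_add voa \<Rightarrow> bool" where
  "voa V \<longleftrightarrow>
     weak_module V (adjoint_mod V) \<and>
     (\<forall>v. vop V v (-1) (vac V) = v \<and> (\<forall>n\<ge>0. vop V v n (vac V) = 0)) \<and>
     internal_direct_sum (vscale V) UNIV (vgrade V) UNIV \<and>
     (\<forall>n. fin_dim (vscale V) (vgrade V n)) \<and>
     vector_space.dim (vscale V) (vgrade V 0) = 1 \<and>
     vac V \<in> vgrade V 0 \<and> cvec V \<in> vgrade V 2 \<and>
     (\<forall>n. \<forall>v\<in>vgrade V n. Vir V (adjoint_mod V) 0 v = vscale V (of_nat n) v) \<and>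
     (\<forall>m n v. Vir V (adjoint_mod V) m (Vir V (adjoint_mod V) n v)
              - Vir V (adjoint_mod V) n (Vir V (adjoint_mod V) m v) =
        vscale V (of_int (m - n)) (Vir V (adjoint_mod V) (m + n) v) +
        vscale V (if m + n = 0 then ccharge V / 12 * of_int (m ^ 3 - m) else 0) v) \<and>
     (\<forall>u n v. vop V (Vir V (adjoint_mod V) (-1) u) n v = vscale V (- of_int n) (vop V u (n - 1) v))"

definition C2_cofinite :: "'v::ab_group_add voa \<Rightarrow> bool" where
  "C2_cofinite V \<longleftrightarrow>
     (\<exists>F. finite F \<and> module.span (vscale V) ({vop V u (-2) v | u v. True} \<union> F) = UNIV)"

definition submodule :: "('v, 'w::ab_group_add) vmod \<Rightarrow> 'w set \<Rightarrow> bool" where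
  "submodule M N \<longleftrightarrow> module.subspace (mscale M) N \<and> N \<subseteq> mcar M \<and> (\<forall>u n. \<forall>w\<in>N. mop M u n w \<in> N)"

definition simple_module :: "('v, 'w::ab_group_add) vmod \<Rightarrow> bool" where
  "simple_module M \<longleftrightarrow> mcar M \<noteq> {0} \<and> (\<forall>N. submodule M N \<longrightarrow> N = {0} \<or> N = mcar M)"

definition completely_reducible :: "('v, 'w::ab_group_add) vmod \<Rightarrow> bool" where
  "completely_reducible M \<longleftrightarrow>
     (\<exists>S. (\<forall>N\<in>S. submodule M N \<and> simple_module (M\<lparr>mcar := N\<rparr>)) \<and>
          internal_direct_sum (mscale M) S (\<lambda>N. N) (mcar M))"

definition admissible :: "'v::ab_group_add voa \<Rightarrow> ('v, 'w::ab_group_add) vmod \<Rightarrow> bool" where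
  "admissible V M \<longleftrightarrow> weak_module V M \<and>
     (\<exists>G :: int \<Rightarrow> 'w set.
        (\<forall>j<0. G j = {0}) \<and> internal_direct_sum (mscale M) UNIV G (mcar M) \<and>
        (\<forall>k v m n. \<forall>w\<in>G n. v \<in> vgrade V k \<longrightarrow> mop M v m w \<in> G (n + int k - m - 1)))"

definition Omega :: "'v::ab_group_add voa \<Rightarrow> ('v, 'w::ab_group_add) vmod \<Rightarrow> 'w set" where
  "Omega V M = {w\<in>mcar M. \<forall>k v n. v \<in> vgrade V k \<and> int k \<le> n \<longrightarrow> mop M v n w = 0}"

text \<open>
  HOL cannot quantify over all types of modules. A VOA has countable dimension, so a module
  generated by a finite-dimensional subspace has countable dimension, hence is isomorphic to
  one carried by a subspace of \<^typ>\<open>complex poly\<close>, which has countably infinite dimension.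
\<close>

definition rational_voa :: "'v::ab_group_add voa \<Rightarrow> bool" where
  "rational_voa V \<longleftrightarrow>
     (\<forall>M :: ('v, complex poly) vmod.
        admissible V M \<and> fin_dim (mscale M) (Omega V M) \<and>
        (\<forall>N. submodule M N \<and> Omega V M \<subseteq> N \<longrightarrow> N = mcar M) \<longrightarrow>
        completely_reducible M)"

definition L0_eigenspace ::
    "'v::ab_group_add voa \<Rightarrow> ('v, 'w::ab_group_add) vmod \<Rightarrow> complex \<Rightarrow> 'w set" where
  "L0_eigenspace V M a = {w\<in>mcar M. Vir V M 0 w = mscale M a w}"

definition voa_module :: "'v::ab_group_add voa \<Rightarrow> ('v, 'w::ab_group_add) vmod \<Rightarrow> bool" where
  "voa_module V M \<longleftrightarrow> weak_module V M \<and>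
     internal_direct_sum (mscale M) UNIV (L0_eigenspace V M) (mcar M) \<and>
     (\<forall>a. fin_dim (mscale M) (L0_eigenspace V M a)) \<and>
     (\<exists>E. finite E \<and> {a. L0_eigenspace V M a \<noteq> {0}} \<subseteq> {e + of_nat n | e n. e \<in> E})"

definition conf_weight :: "'v::ab_group_add voa \<Rightarrow> ('v, 'w::ab_group_add) vmod \<Rightarrow> complex" where
  "conf_weight V M = (THE d. L0_eigenspace V M d \<noteq> {0} \<and>
     (\<forall>a. L0_eigenspace V M a \<noteq> {0} \<longrightarrow> a - d \<in> \<nat>))"


section \<open>Changes of coordinate\<close>

text \<open>
  \<open>vf_exp a\<close> is the power series \<open>exp (\<Sum>n>0. a n * z^(n+1) * d/dz) z\<close>. The vector field
  raises the order of vanishing, so the \<open>m\<close>-th coefficient only involves the terms \<open>k \<le> m\<close>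
  of the exponential series.
\<close>

definition vf_deriv :: "(nat \<Rightarrow> complex) \<Rightarrow> complex fps \<Rightarrow> complex fps" where
  "vf_deriv a F = Abs_fps (\<lambda>k. if 2 \<le> k then a (k - 1) else 0) * fps_deriv F"

definition vf_exp :: "(nat \<Rightarrow> complex) \<Rightarrow> complex fps" where
  "vf_exp a = Abs_fps (\<lambda>m. \<Sum>k\<le>m. fps_nth ((vf_deriv a ^^ k) fps_X) m / fact k)"

definition vf_coeffs :: "(complex \<Rightarrow> complex) \<Rightarrow> nat \<Rightarrow> complex" where
  "vf_coeffs \<rho> = (THE a. a 0 = 0 \<and>
     Abs_fps (\<lambda>m. (deriv ^^ m) \<rho> 0 / fact m) = fps_const (deriv \<rho> 0) * vf_exp a)"

definition exp_L_pos ::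
    "'v::ab_group_add voa \<Rightarrow> ('v, 'w::ab_group_add) vmod \<Rightarrow> (nat \<Rightarrow> complex) \<Rightarrow> 'w \<Rightarrow> 'w" where
  "exp_L_pos V M a w = Sum_any (\<lambda>k::nat. mscale M (1 / fact k)
     (((\<lambda>x. Sum_any (\<lambda>n::nat. if 0 < n then mscale M (a n) (Vir V M (int n) x) else 0)) ^^ k) w))"

text \<open>\<open>pow_L0 V M d r\<close> is \<open>r\<close> to the power \<open>L\<^sub>0 - d\<close>, where \<open>L\<^sub>0 - d\<close> has eigenvalues in \<open>\<nat>\<close>.\<close>

definition pow_L0 ::
    "'v::ab_group_add voa \<Rightarrow> ('v, 'w::ab_group_add) vmod \<Rightarrow> complex \<Rightarrow> complex \<Rightarrow> 'w \<Rightarrow> 'w" where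
  "pow_L0 V M d r w = Sum_any (\<lambda>n::nat. mscale M (r ^ n)
     ((THE e. (\<forall>n. e n \<in> L0_eigenspace V M (d + of_nat n)) \<and>
              finite {n. e n \<noteq> 0} \<and> w = Sum_any e) n))"

definition U_op ::
    "'v::ab_group_add voa \<Rightarrow> ('v, 'w::ab_group_add) vmod \<Rightarrow> complex \<Rightarrow> (complex \<Rightarrow> complex) \<Rightarrow> 'w \<Rightarrow> 'w" where
  "U_op V M d \<rho> w = pow_L0 V M d (deriv \<rho> 0) (exp_L_pos V M (vf_coeffs \<rho>) w)"


section \<open>Families of 1-pointed Riemann surfaces\<close>

text \<open>
  Functions of several complex variables: real-differentiable with complex-linear derivative.
  The scalar multiplication is a parameter because product types carry no complex one.
\<close>

definition holo_wrt ::
    "(complex \<Rightarrow> 'a \<Rightarrow> 'a) \<Rightarrow> ('a::real_normed_vector \<Rightarrow> complex) \<Rightarrow> 'a set \<Rightarrow> bool" where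
  "holo_wrt sc f S \<longleftrightarrow> (\<forall>x\<in>S. \<exists>D. (f has_derivative D) (at x) \<and> (\<forall>a v. D (sc a v) = a * D v))"

abbreviation holo_base :: "(complex^'n \<Rightarrow> complex) \<Rightarrow> (complex^'n) set \<Rightarrow> bool" where
  "holo_base \<equiv> holo_wrt (*s)"

abbreviation holo_tot :: "(complex \<times> (complex^'n) \<Rightarrow> complex) \<Rightarrow> (complex \<times> (complex^'n)) set \<Rightarrow> bool" where
  "holo_tot \<equiv> holo_wrt (\<lambda>a (z, b). (a * z, a *s b))"

text \<open>
  The base is an open subset of \<open>\<complex>\<^sup>n\<close>. The complex structure of the total space is
  recorded by the set of all pairs \<open>(D, \<eta>)\<close> with \<open>D\<close> open and \<open>\<eta>\<close> holomorphic on \<open>D\<close> and injective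
  on fibers; then \<open>(\<eta>, \<pi>)\<close> is a system of coordinates on \<open>D\<close>.
\<close>

type_synonym 'c chart = "'c set \<times> ('c \<Rightarrow> complex)"

record ('c, 'n) family =
  tot :: "'c set"
  base :: "(complex^'n::finite) set"
  proj :: "'c \<Rightarrow> complex^'n"
  sect :: "complex^'n \<Rightarrow> 'c"
  charts :: "'c chart set"

definition chart_pt :: "('c, 'n::finite) family \<Rightarrow> 'c chart \<Rightarrow> complex \<times> (complex^'n) \<Rightarrow> 'c" where
  "chart_pt X \<kappa> = inv_into (fst \<kappa>) (\<lambda>p. (snd \<kappa> p, proj X p))"

definition in_chart ::
    "('c, 'n::finite) family \<Rightarrow> 'c chart \<Rightarrow> ('c \<Rightarrow> 'a) \<Rightarrow> complex \<times> (complex^'n) \<Rightarrow> 'a" where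
  "in_chart X \<kappa> f = f \<circ> chart_pt X \<kappa>"

definition partial :: "'n::finite \<Rightarrow> (complex^'n \<Rightarrow> complex) \<Rightarrow> complex^'n \<Rightarrow> complex" where
  "partial j f b = deriv (\<lambda>s. f (b + s *s axis j 1)) 0"

text \<open>The \<open>k\<close>-th derivative of \<open>f\<close> at \<open>p\<close> with respect to \<open>\<eta>\<close>, along the fiber.\<close>

definition fib_deriv ::
    "('c, 'n::finite) family \<Rightarrow> 'c chart \<Rightarrow> nat \<Rightarrow> ('c \<Rightarrow> complex) \<Rightarrow> 'c \<Rightarrow> complex" where
  "fib_deriv X \<kappa> k f p = (deriv ^^ k) (\<lambda>t. in_chart X \<kappa> f (t, proj X p)) (snd \<kappa> p)"

definition schwarzian ::
    "('c, 'n::finite) family \<Rightarrow> 'c chart \<Rightarrow> ('c \<Rightarrow> complex) \<Rightarrow> 'c \<Rightarrow> complex" where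
  "schwarzian X \<kappa> f p =
     fib_deriv X \<kappa> 3 f p / fib_deriv X \<kappa> 1 f p
     - 3 / 2 * (fib_deriv X \<kappa> 2 f p / fib_deriv X \<kappa> 1 f p)\<^sup>2"

definition projective_structure :: "('c, 'n::finite) family \<Rightarrow> 'c chart set \<Rightarrow> bool" where
  "projective_structure X P \<longleftrightarrow>
     P \<subseteq> charts X \<and> tot X \<subseteq> (\<Union>\<kappa>\<in>P. fst \<kappa>) \<and>
     (\<forall>\<kappa>\<in>P. \<forall>\<mu>\<in>P. \<forall>p\<in>fst \<kappa> \<inter> fst \<mu>. schwarzian X \<kappa> (snd \<mu>) p = 0) \<and>
     (\<forall>\<mu>\<in>charts X. (\<forall>\<kappa>\<in>P. \<forall>p\<in>fst \<kappa> \<inter> fst \<mu>. schwarzian X \<kappa> (snd \<mu>) p = 0) \<longrightarrow> \<mu> \<in> P)"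

definition schwarzian_ps :: "('c, 'n::finite) family \<Rightarrow> 'c chart \<Rightarrow> 'c chart set \<Rightarrow> 'c \<Rightarrow> complex" where
  "schwarzian_ps X \<kappa> P p = schwarzian X \<kappa> (snd (SOME \<mu>. \<mu> \<in> P \<and> p \<in> fst \<mu>)) p"

text \<open>Local coordinates at the marked point, over an open subset \<open>U\<close> of the base.\<close>

definition local_coord :: "('c, 'n::finite) family \<Rightarrow> (complex^'n) set \<Rightarrow> 'c chart \<Rightarrow> bool" where
  "local_coord X U \<kappa> \<longleftrightarrow> \<kappa> \<in> charts X \<and> (\<forall>b\<in>U. sect X b \<in> fst \<kappa> \<and> snd \<kappa> (sect X b) = 0)"

text \<open>The germs \<open>\<rho>(\<eta>|\<mu>)\<^sub>p\<close> and \<open>(\<eta>|\<mu>)\<^sub>b\<close>.\<close>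

definition trans_germ ::
    "('c, 'n::finite) family \<Rightarrow> 'c chart \<Rightarrow> 'c chart \<Rightarrow> 'c \<Rightarrow> complex \<Rightarrow> complex" where
  "trans_germ X \<eta> \<mu> p z = snd \<eta> (chart_pt X \<mu> (z + snd \<mu> p, proj X p)) - snd \<eta> p"

definition coord_germ ::
    "('c, 'n::finite) family \<Rightarrow> 'c chart \<Rightarrow> 'c chart \<Rightarrow> complex^'n \<Rightarrow> complex \<Rightarrow> complex" where
  "coord_germ X \<eta> \<mu> b z = snd \<eta> (chart_pt X \<mu> (z, b))"

text \<open>
  \<open>f\<close>, expressed in the coordinates \<open>(\<eta>, \<pi>)\<close>, is over \<open>U\<close> holomorphic away from the marked
  points and has a pole of finite order along them. Locally \<open>f\<close> is a finite sum of
  holomorphic functions times fixed vectors.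
\<close>

definition meromorphic_along_sect ::
    "('c, 'n::finite) family \<Rightarrow> (complex^'n) set \<Rightarrow> (complex \<Rightarrow> 'v::ab_group_add \<Rightarrow> 'v) \<Rightarrow>
     'c chart \<Rightarrow> ('c \<Rightarrow> 'v) \<Rightarrow> bool" where
  "meromorphic_along_sect X U sc \<kappa> f \<longleftrightarrow>
     (\<forall>p\<in>fst \<kappa>. proj X p \<in> U \<longrightarrow>
       (p \<noteq> sect X (proj X p) \<longrightarrow>
         (\<exists>N E g. open N \<and> (snd \<kappa> p, proj X p) \<in> N \<and> finite E \<and> (\<forall>e\<in>E. holo_tot (g e) N) \<and>
            (\<forall>y\<in>N. in_chart X \<kappa> f y = (\<Sum>e\<in>E. sc (g e y) e)))) \<and>
       (p = sect X (proj X p) \<longrightarrow>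
         (\<exists>m N E g. open N \<and> (snd \<kappa> p, proj X p) \<in> N \<and> finite E \<and> (\<forall>e\<in>E. holo_tot (g e) N) \<and>
            (\<forall>(t, b)\<in>N. t \<noteq> snd \<kappa> (sect X b) \<longrightarrow>
               sc ((t - snd \<kappa> (sect X b)) ^ m) (in_chart X \<kappa> f (t, b)) = (\<Sum>e\<in>E. sc (g e (t, b)) e)))))"


section \<open>Conformal blocks\<close>

text \<open>
  A section \<open>v\<close> over \<open>\<pi>\<^sup>-\<^sup>1(U)\<close> of the sheaf of VOAs tensored with the relative dualizing sheaf,
  with finite poles along the marked points, is the family of functions \<open>u \<eta>\<close> for which
  \<open>u \<eta> d\<eta>\<close> is the expression of \<open>v\<close> in the trivialization given by \<open>\<eta>\<close>.
\<close>

definition voa_section ::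
    "('c, 'n::finite) family \<Rightarrow> 'v::ab_group_add voa \<Rightarrow> (complex^'n) set \<Rightarrow>
     ('c chart \<Rightarrow> 'c \<Rightarrow> 'v) \<Rightarrow> bool" where
  "voa_section X V U u \<longleftrightarrow>
     (\<forall>\<eta>\<in>charts X. meromorphic_along_sect X U (vscale V) \<eta> (u \<eta>)) \<and>
     (\<forall>\<eta>\<in>charts X. \<forall>\<mu>\<in>charts X. \<forall>p\<in>fst \<eta> \<inter> fst \<mu>.
        proj X p \<in> U \<and> p \<noteq> sect X (proj X p) \<longrightarrow>
        vscale V (fib_deriv X \<mu> 1 (snd \<eta>) p) (u \<eta> p) =
          U_op V (adjoint_mod V) 0 (trans_germ X \<eta> \<mu> p) (u \<mu> p))"

text \<open>\<open>Res\<^bsub>z=0\<^esub> Y(u(z), z) w dz\<close>, where \<open>Y(u, z) = \<Sum>n. Y(u)\<^sub>n z^(-n-1)\<close>.\<close>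

definition res_act ::
    "('v, 'w::ab_group_add) vmod \<Rightarrow> (complex \<Rightarrow> 'v) \<Rightarrow> 'w \<Rightarrow> 'w" where
  "res_act M u w = Sum_any (\<lambda>n::int.
     vec_apply (mscale M) (\<lambda>f. residue f 0) (\<lambda>z. mscale M (z powi (- n - 1)) (mop M (u z) n w)))"

text \<open>
  A linear functional on the sheaf \<open>\<W>(M)\<close> over \<open>U\<close> is a family \<open>\<phi>\<close>:
  \<open>\<phi> \<eta> b\<close> is the functional on \<open>M\<close> that it induces at \<open>b\<close> in the trivialization given by
  the local coordinate \<open>\<eta>\<close>. Since the trivialized sheaf is freely generated over the holomorphic functions
  by constant sections \<open>w\<close>, linearity over the holomorphic functions amounts to fiberwise
  linearity together with holomorphy of all \<open>b \<mapsto> \<phi> \<eta> b w\<close>. Sections of the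
  dual of the sheaf of covacua are the functionals that vanish on all \<open>v \<cdot> w\<close>.
\<close>

type_synonym ('c, 'n, 'w) dual_family = "'c chart \<Rightarrow> complex^'n \<Rightarrow> 'w \<Rightarrow> complex"

definition conformal_block ::
    "('c, 'n::finite) family \<Rightarrow> 'v::ab_group_add voa \<Rightarrow> ('v, 'w::ab_group_add) vmod \<Rightarrow>
     (complex^'n) set \<Rightarrow> ('c, 'n, 'w) dual_family \<Rightarrow> bool" where
  "conformal_block X V M U \<phi> \<longleftrightarrow>
     (\<forall>U' \<eta>. open U' \<and> U' \<subseteq> U \<and> local_coord X U' \<eta> \<longrightarrow>
        (\<forall>w\<in>mcar M. holo_base (\<lambda>b. \<phi> \<eta> b w) U') \<and>
        (\<forall>b\<in>U'. \<forall>w\<in>mcar M. \<forall>w'\<in>mcar M. \<phi> \<eta> b (w + w') = \<phi> \<eta> b w + \<phi> \<eta> b w') \<and>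
        (\<forall>b\<in>U'. \<forall>a. \<forall>w\<in>mcar M. \<phi> \<eta> b (mscale M a w) = a * \<phi> \<eta> b w) \<and>
        (\<forall>\<mu>. local_coord X U' \<mu> \<longrightarrow> (\<forall>b\<in>U'. \<forall>w\<in>mcar M.
            \<phi> \<eta> b (U_op V M (conf_weight V M) (coord_germ X \<eta> \<mu> b) w) = \<phi> \<mu> b w)) \<and>
        (\<forall>u. voa_section X V U' u \<longrightarrow> (\<forall>b\<in>U'. \<forall>w\<in>mcar M.
            \<phi> \<eta> b (res_act M (\<lambda>z. in_chart X \<eta> (u \<eta>) (z, b)) w) = 0)))"


section \<open>Connections\<close>

text \<open>A vector field on the base is given by its components \<open>g j\<close> with respect to the \<open>\<partial>/\<partial>\<tau>\<^sub>j\<close>.\<close>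

definition vf_apply ::
    "('n::finite \<Rightarrow> complex^'n \<Rightarrow> complex) \<Rightarrow> (complex^'n \<Rightarrow> complex) \<Rightarrow> complex^'n \<Rightarrow> complex" where
  "vf_apply g f b = (\<Sum>j\<in>UNIV. g j b * partial j f b)"

definition coord_vf :: "'n::finite \<Rightarrow> 'n \<Rightarrow> complex^'n \<Rightarrow> complex" where
  "coord_vf i j b = (if j = i then 1 else 0)"

text \<open>
  A lift over \<open>U\<close> of the vector field \<open>g\<close> to \<open>\<C>\<close>, with finite poles along the marked points,
  equals \<open>h \<eta> \<partial>\<^sub>\<eta> + \<Sum>j. g\<^sub>j \<partial>\<^bsub>\<tau> j\<^esub>\<close> in the coordinates \<open>(\<eta>, \<tau>)\<close>, that is, \<open>h \<eta>\<close> is the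
  derivative of \<open>\<eta>\<close> along the lift.
\<close>

definition vf_lift ::
    "('c, 'n::finite) family \<Rightarrow> (complex^'n) set \<Rightarrow> ('n \<Rightarrow> complex^'n \<Rightarrow> complex) \<Rightarrow>
     ('c chart \<Rightarrow> 'c \<Rightarrow> complex) \<Rightarrow> bool" where
  "vf_lift X U g h \<longleftrightarrow>
     (\<forall>\<eta>\<in>charts X. meromorphic_along_sect X U (*) \<eta> (h \<eta>)) \<and>
     (\<forall>\<eta>\<in>charts X. \<forall>\<mu>\<in>charts X. \<forall>p\<in>fst \<eta> \<inter> fst \<mu>.
        proj X p \<in> U \<and> p \<noteq> sect X (proj X p) \<longrightarrow>
        h \<eta> p = h \<mu> p * fib_deriv X \<mu> 1 (snd \<eta>) p +
                vf_apply g (\<lambda>b. in_chart X \<mu> (snd \<eta>) (snd \<mu> p, b)) (proj X p))"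

text \<open>\<open>\<nabla>\<^sup>(\<^sup>\<eta>\<^sup>)\<close> on sections \<open>s\<close> of \<open>\<W>(M)\<close> in the trivialization given by \<open>\<eta>\<close>, and its dual.\<close>

definition nabla_eta ::
    "('c, 'n::finite) family \<Rightarrow> 'v::ab_group_add voa \<Rightarrow> ('v, 'w::ab_group_add) vmod \<Rightarrow> 'c chart \<Rightarrow>
     ('n \<Rightarrow> complex^'n \<Rightarrow> complex) \<Rightarrow> ('c chart \<Rightarrow> 'c \<Rightarrow> complex) \<Rightarrow>
     (complex^'n \<Rightarrow> 'w) \<Rightarrow> complex^'n \<Rightarrow> 'w" where
  "nabla_eta X V M \<eta> g h s b =
     (\<Sum>j\<in>UNIV. mscale M (g j b) (vec_apply (mscale M) (\<lambda>f. partial j f b) s))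
     - res_act M (\<lambda>z. vscale V (in_chart X \<eta> (h \<eta>) (z, b)) (cvec V)) (s b)"

definition nabla_eta_dual ::
    "('c, 'n::finite) family \<Rightarrow> 'v::ab_group_add voa \<Rightarrow> ('v, 'w::ab_group_add) vmod \<Rightarrow> 'c chart \<Rightarrow>
     ('n \<Rightarrow> complex^'n \<Rightarrow> complex) \<Rightarrow> ('c chart \<Rightarrow> 'c \<Rightarrow> complex) \<Rightarrow>
     ('c, 'n, 'w) dual_family \<Rightarrow> complex^'n \<Rightarrow> 'w \<Rightarrow> complex" where
  "nabla_eta_dual X V M \<eta> g h \<phi> b w =
     vf_apply g (\<lambda>b. \<phi> \<eta> b w) b - \<phi> \<eta> b (nabla_eta X V M \<eta> g h (\<lambda>_. w) b)"

text \<open>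
  A jet \<open>\<nu>\<close>, a section of the pullback along the marked points of the relative dualizing sheaf, is
  the family of its coefficients: \<open>\<nu> \<eta> b\<close> is \<open>\<nu>/\<sigma>\<^sup>*d\<eta>\<close> at \<open>b\<close>.
  The derivative of a logarithm is the logarithmic derivative, so no branch is chosen.
\<close>

definition log_deriv_jet ::
    "('n::finite \<Rightarrow> complex^'n \<Rightarrow> complex) \<Rightarrow> ('c chart \<Rightarrow> complex^'n \<Rightarrow> complex) \<Rightarrow>
     'c chart \<Rightarrow> complex^'n \<Rightarrow> complex" where
  "log_deriv_jet g \<nu> \<eta> b = vf_apply g (\<lambda>b. 1 / \<nu> \<eta> b) b / (1 / \<nu> \<eta> b)"

text \<open>
  \<open>nabla X V M P \<nu> \<eta> g h \<phi>\<close> is the covariant derivative of \<open>\<phi>\<close> along \<open>g\<close> given by the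
  projective structure \<open>P\<close> and the jet \<open>\<nu>\<close>, computed with the local coordinate \<open>\<eta>\<close> and the lift \<open>h\<close>
  of \<open>g\<close>, and then transported to all local coordinates \<open>\<mu>\<close>.
\<close>

definition nabla ::
    "('c, 'n::finite) family \<Rightarrow> 'v::ab_group_add voa \<Rightarrow> ('v, 'w::ab_group_add) vmod \<Rightarrow>
     'c chart set \<Rightarrow> ('c chart \<Rightarrow> complex^'n \<Rightarrow> complex) \<Rightarrow> 'c chart \<Rightarrow>
     ('n \<Rightarrow> complex^'n \<Rightarrow> complex) \<Rightarrow> ('c chart \<Rightarrow> 'c \<Rightarrow> complex) \<Rightarrow>
     ('c, 'n, 'w) dual_family \<Rightarrow> ('c, 'n, 'w) dual_family" where
  "nabla X V M P \<nu> \<eta> g h \<phi> = (\<lambda>\<mu> b w.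
     let x = U_op V M (conf_weight V M) (coord_germ X \<eta> \<mu> b) w
     in nabla_eta_dual X V M \<eta> g h \<phi> b x
        - residue (\<lambda>t. ccharge V / 12 * in_chart X \<eta> (h \<eta>) (t, b)
                       * in_chart X \<eta> (schwarzian_ps X \<eta> P) (t, b)) 0 * \<phi> \<eta> b x
        - conf_weight V M * log_deriv_jet g \<nu> \<eta> b * \<phi> \<eta> b x)"


section \<open>The family of elliptic curves\<close>

text \<open>Points of the base are \<open>b\<close> with \<open>b $ 1 = \<tau>\<close> and \<open>b $ 2 = \<zeta>\<close>.\<close>

definition ell_base :: "(complex^2) set" where
  "ell_base = {b. 0 < Im (b $ 1) \<and> b $ 2 \<noteq> 0}"

definition ell_class :: "complex \<times> (complex^2) \<Rightarrow> (complex \<times> (complex^2)) set" where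
  "ell_class = (\<lambda>(z, b). {(z + of_int k + of_int l * b $ 1, b) | k l. True})"

definition ell_proj :: "(complex \<times> (complex^2)) set \<Rightarrow> complex^2" where
  "ell_proj p = snd (SOME x. x \<in> p)"

definition ell_charts :: "(complex \<times> (complex^2)) set chart set" where
  "ell_charts = {(D, \<eta>).
     D \<subseteq> ell_class ` (UNIV \<times> ell_base) \<and>
     open {x \<in> UNIV \<times> ell_base. ell_class x \<in> D} \<and>
     holo_tot (\<eta> \<circ> ell_class) {x \<in> UNIV \<times> ell_base. ell_class x \<in> D} \<and>
     (\<forall>p\<in>D. \<forall>p'\<in>D. ell_proj p = ell_proj p' \<and> \<eta> p = \<eta> p' \<longrightarrow> p = p')}"

definition ell_family :: "((complex \<times> (complex^2)) set, 2) family" where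
  "ell_family = \<lparr>
     tot = ell_class ` (UNIV \<times> ell_base),
     base = ell_base,
     proj = ell_proj,
     sect = (\<lambda>b. ell_class (0, b)),
     charts = ell_charts\<rparr>"

text \<open>
  The lift to \<open>\<complex> \<times> ell_base\<close> of \<open>P\<close> contains \<open>f\<close>, on open sets \<open>N\<close> where \<open>f\<close> is
  injective on fibers. It suffices to consider small \<open>N\<close>, which embed into the quotient.
\<close>

definition lift_contains ::
    "(complex \<times> (complex^2)) set chart set \<Rightarrow> (complex \<times> (complex^2) \<Rightarrow> complex) \<Rightarrow> bool" where
  "lift_contains P f \<longleftrightarrow>
     (\<forall>N. open N \<and> N \<subseteq> UNIV \<times> ell_base \<and> inj_on ell_class N \<and>
          (\<forall>x\<in>N. \<forall>y\<in>N. snd x = snd y \<and> f x = f y \<longrightarrow> x = y) \<longrightarrow>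
          (ell_class ` N, f \<circ> inv_into N ell_class) \<in> P)"

text \<open>The jet \<open>a dz\<close>: along the marked points \<open>d\<eta> = (\<partial>\<eta>/\<partial>z) dz\<close>.\<close>

definition ell_jet ::
    "(complex^2 \<Rightarrow> complex) \<Rightarrow> (complex \<times> (complex^2)) set chart \<Rightarrow> complex^2 \<Rightarrow> complex" where
  "ell_jet a \<eta> b = a b / deriv (\<lambda>z. snd \<eta> (ell_class (z, b))) 0"

end

theory Submission
  imports Defs
begin

text \<open>
  Both connections differentiate along the same lift and in the same local coordinate \<open>\<eta>\<close>, so
  their difference is the scalar
  \<open>c/12 Res h (S\<^sub>\<eta> P' - S\<^sub>\<eta> P) d\<eta>\<close> plus \<open>\<Delta>\<close> times the logarithmic derivative of \<open>\<nu>/\<nu>'\<close>.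
  For the jets that derivative is \<open>0\<close> along \<open>\<tau>\<close> and \<open>1/\<zeta>\<close> along \<open>\<zeta>\<close> (\<open>log_deriv_ell_jet\<close>).

  For the Schwarzians everything is pulled back to the universal cover with its coordinate \<open>z\<close>. By the
  chain rule \<open>S\<^sub>\<eta> P' - S\<^sub>\<eta> P = s (dz/d\<eta>)\<^sup>2\<close>, where \<open>s = 2\<pi>\<^sup>2\<close> is the Schwarzian of \<open>exp (2\<pi>iz)\<close>
  with respect to \<open>z\<close> (\<open>schwarzian_ps_fiber_lift\<close>, \<open>schwarz_exp\<close>). If \<open>H\<close> is the derivative of \<open>z\<close>
  along the lift, then \<open>h = H d\<eta>/dz + \<partial>\<eta>\<close> with the last term, the derivative of \<open>\<eta>\<close> along the base,
  holomorphic. Hence the residue is \<open>s\<close> times the residue of \<open>H dz\<close> at \<open>0\<close> (\<open>residue_lift_difference\<close>).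

  It remains to find this residue. The lift lives on the quotient by \<open>\<int> + \<int>\<tau>\<close>, and the translation
  \<open>z \<mapsto> z + \<tau>\<close> itself moves with \<open>\<tau>\<close>. Along a lift of \<open>\<partial>\<^sub>\<tau>\<close> therefore \<open>H (z + 1) = H z\<close> and
  \<open>H (z + \<tau>) = H z + 1\<close>, whereas along a lift of \<open>\<partial>\<^sub>\<zeta>\<close> the function \<open>H\<close> is doubly periodic.
  Integrating \<open>H\<close> around a period parallelogram gives the residue \<open>-1/(2\<pi>i)\<close> in the first case and
  \<open>0\<close> in the second (\<open>residue_quasi_periodic\<close>, \<open>ell_lift_residue\<close>). In the first case
  the scalar is \<open>c/12 2\<pi>\<^sup>2 (-1/(2\<pi>i)) = i\<pi>c/12\<close>.
\<close>

section \<open>Holomorphic dependence of a derivative on a parameter\<close>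

text \<open>
  The difference quotients in the second variable are holomorphic in the first. Cauchy's estimate for
  the second derivative makes them converge uniformly on the disc, so Weierstrass' theorem applies.
\<close>

lemma partial_deriv_holomorphic_param:
  fixes F :: "complex \<Rightarrow> complex \<Rightarrow> complex"
  assumes r: "0 < r"
    and cont: "continuous_on (cball z0 r \<times> cball s0 r) (\<lambda>(z, s). F z s)"
    and hol_z: "\<And>s. s \<in> cball s0 r \<Longrightarrow> (\<lambda>z. F z s) holomorphic_on ball z0 r"
    and hol_s: "\<And>z. z \<in> ball z0 r \<Longrightarrow> F z holomorphic_on ball s0 r"
  shows "(\<lambda>z. deriv (F z) s0) holomorphic_on ball z0 r"
proof -
  define R where "R = r / 2"
  have R: "0 < R" "R < r" using r by (auto simp: R_def)
  have "bounded ((\<lambda>(z, s). F z s) ` (cball z0 r \<times> cball s0 r))"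
    by (intro compact_imp_bounded compact_continuous_image cont compact_Times compact_cball)
  then obtain B where B: "\<And>z s. z \<in> cball z0 r \<Longrightarrow> s \<in> cball s0 r \<Longrightarrow> cmod (F z s) \<le> B"
    unfolding bounded_iff by fastforce
  define C where "C = fact 2 * B / R ^ 2"
  have second: "cmod ((deriv ^^ 2) (F z) s) \<le> C" if z: "z \<in> ball z0 r" and s: "s \<in> ball s0 R" for z s
    unfolding C_def
  proof (rule Cauchy_inequality)
    have sub: "cball s R \<subseteq> cball s0 r" "ball s R \<subseteq> ball s0 r"
      using s dist_triangle[of s0 _ s] unfolding R_def
      by (auto simp: subset_iff) (smt (verit) field_sum_of_halves)+
    show "F z holomorphic_on ball s R" using hol_s[OF z] sub(2) by (rule holomorphic_on_subset)
    have "continuous_on (cball s R) ((\<lambda>(z, s). F z s) \<circ> (\<lambda>s. (z, s)))"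
      by (intro continuous_on_compose continuous_intros continuous_on_subset[OF cont])
         (use z sub in auto)
    then show "continuous_on (cball s R) (F z)" by (simp add: o_def)
    show "0 < R" by (rule R)
    show "cmod (F z x) \<le> B" if "cmod (s - x) = R" for x
      using that sub(1) z by (intro B) (auto simp: dist_norm subset_iff)
  qed
  have quot: "cmod ((F z (s0 + e) - F z s0) / e - deriv (F z) s0) \<le> C * cmod e"
    if z: "z \<in> ball z0 r" and e: "e \<noteq> 0" "cmod e < R" for z e
  proof -
    have "cmod ((deriv ^^ 0) (F z) (s0 + e) -
        (\<Sum>i\<le>1. (deriv ^^ i) (F z) s0 * (s0 + e - s0) ^ i / fact i)) \<le> C * cmod (s0 + e - s0) ^ Suc 1 / fact 1"
    proof (rule complex_Taylor[of "ball s0 R" 1 "\<lambda>i. (deriv ^^ i) (F z)"])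
      show "((deriv ^^ i) (F z) has_field_derivative (deriv ^^ Suc i) (F z) x) (at x within ball s0 R)"
        if x: "x \<in> ball s0 R" for i x
      proof -
        have "(deriv ^^ i) (F z) holomorphic_on ball s0 r"
          by (intro holomorphic_higher_deriv hol_s z) auto
        then have "((deriv ^^ i) (F z) has_field_derivative deriv ((deriv ^^ i) (F z)) x) (at x)"
          by (rule holomorphic_derivI) (use x R in auto)
        then show ?thesis by (simp add: has_field_derivative_at_within)
      qed
      show "cmod ((deriv ^^ Suc 1) (F z) x) \<le> C" if "x \<in> ball s0 R" for x
        using second[OF z that] by (simp add: numeral_2_eq_2)
    qed (use R e in \<open>auto simp: dist_norm\<close>)
    then have "cmod (F z (s0 + e) - F z s0 - deriv (F z) s0 * e) \<le> C * cmod e * cmod e"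
      by (simp add: algebra_simps power2_eq_square)
    moreover have "F z (s0 + e) - F z s0 - deriv (F z) s0 * e =
        ((F z (s0 + e) - F z s0) / e - deriv (F z) s0) * e"
      using e by (simp add: field_simps)
    ultimately show ?thesis using e by (simp add: norm_mult)
  qed
  define e where "e = (\<lambda>n::nat. complex_of_real (R / 2 * (1 / 2) ^ n))"
  have ne: "cmod (e n) = R / 2 * (1 / 2) ^ n" for n
    using R by (simp add: e_def norm_mult norm_power norm_divide)
  have e: "e n \<noteq> 0" "cmod (e n) < R" for n
  proof -
    have "R / 2 * (1 / 2) ^ n \<le> R / 2 * 1"
      using R by (intro mult_left_mono power_le_one) auto
    then show "e n \<noteq> 0" "cmod (e n) < R" using R unfolding ne by (auto simp: e_def)
  qed
  have "(\<lambda>n. C * (R / 2 * (1 / 2) ^ n)) \<longlonglongrightarrow> C * (R / 2 * 0)"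
    by (intro tendsto_intros LIMSEQ_power_zero) auto
  then have "(\<lambda>n. C * cmod (e n)) \<longlonglongrightarrow> 0" by (simp add: ne)
  then have lim: "(\<lambda>n. C * cmod (e n)) \<longlonglongrightarrow> 0" by simp
  show ?thesis
  proof (rule holomorphic_uniform_sequence)
    show "open (ball z0 r)" by simp
    show "(\<lambda>z. (F z (s0 + e n) - F z s0) / e n) holomorphic_on ball z0 r" for n
      using e[of n] R by (intro holomorphic_intros hol_z) (auto simp: dist_norm)
    fix x assume "x \<in> ball z0 r"
    then obtain d where d: "0 < d" "cball x d \<subseteq> ball z0 r"
      by (meson open_ball open_contains_cball)
    have "uniform_limit (cball x d) (\<lambda>n z. (F z (s0 + e n) - F z s0) / e n)
        (\<lambda>z. deriv (F z) s0) sequentially"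
    proof (rule uniform_limitI)
      fix \<epsilon> :: real assume "0 < \<epsilon>"
      then have "\<forall>\<^sub>F n in sequentially. C * cmod (e n) < \<epsilon>"
        using lim by (auto dest: order_tendstoD)
      then show "\<forall>\<^sub>F n in sequentially. \<forall>z\<in>cball x d.
          dist ((F z (s0 + e n) - F z s0) / e n) (deriv (F z) s0) < \<epsilon>"
      proof (rule eventually_mono, intro ballI)
        fix n z assume "C * cmod (e n) < \<epsilon>" "z \<in> cball x d"
        then show "dist ((F z (s0 + e n) - F z s0) / e n) (deriv (F z) s0) < \<epsilon>"
          using quot[of z "e n"] e[of n] d by (auto simp: dist_norm)
      qed
    qed
    then show "\<exists>d>0. cball x d \<subseteq> ball z0 r \<and>
        uniform_limit (cball x d) (\<lambda>n z. (F z (s0 + e n) - F z s0) / e n) (\<lambda>z. deriv (F z) s0) sequentially"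
      using d by blast
  qed
qed

section \<open>Residues under substitution and of quasi-periodic functions\<close>

text \<open>
  The image under \<open>\<psi>\<close> of a small circle around \<open>0\<close> has winding number \<open>1\<close>, because the
  logarithmic derivative of \<open>\<psi>\<close> has residue \<open>1\<close> there. Up to the factor \<open>2\<pi>i\<close> both residues are
  the integral of \<open>H\<close> over that image.
\<close>

lemma residue_substitution:
  assumes S: "open S" "0 \<in> S" and \<psi>: "\<psi> holomorphic_on S" "inj_on \<psi> S" "\<psi> 0 = 0"
    and T: "open T" "0 \<in> T" and H: "H holomorphic_on T - {0}"
  shows "residue (\<lambda>t. H (\<psi> t) * deriv \<psi> t) 0 = residue H 0"
proof -
  obtain \<rho> where \<rho>: "0 < \<rho>" "ball 0 \<rho> \<subseteq> T" using T openE by blast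
  have "open (\<psi> -` ball 0 \<rho> \<inter> S)"
    using \<psi>(1) S(1) by (meson continuous_open_vimage holomorphic_on_imp_continuous_on
      continuous_on_open_vimage open_ball)
  moreover have "0 \<in> \<psi> -` ball 0 \<rho> \<inter> S" using \<rho> \<psi> S by auto
  ultimately obtain r where r: "0 < r" "cball 0 r \<subseteq> \<psi> -` ball 0 \<rho> \<inter> S"
    using open_contains_cball_eq by blast
  define W where "W = \<psi> -` ball 0 \<rho> \<inter> S"
  have W: "open W" "0 \<in> W" "W \<subseteq> S" "\<psi> ` W \<subseteq> ball 0 \<rho>" "cball 0 r \<subseteq> W"
    using \<open>open (\<psi> -` ball 0 \<rho> \<inter> S)\<close> \<open>0 \<in> \<psi> -` ball 0 \<rho> \<inter> S\<close> r by (auto simp: W_def)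
  have \<psi>W: "\<psi> holomorphic_on W" using \<psi>(1) W(3) by (rule holomorphic_on_subset)
  have nz: "\<psi> t \<noteq> 0" if "t \<in> W - {0}" for t
    using that \<psi> W S by (metis DiffD1 DiffD2 inj_onD insertI1 subsetD)
  define \<gamma> where "\<gamma> = circlepath 0 r"
  have im: "path_image \<gamma> \<subseteq> W - {0}" using r W(5) by (auto simp: \<gamma>_def)
  have \<gamma>: "valid_path \<gamma>" "pathfinish \<gamma> = pathstart \<gamma>" by (auto simp: \<gamma>_def)
  have an: "\<psi> analytic_on W" using W \<psi>W by (simp add: analytic_on_open)
  have vp: "valid_path (\<psi> \<circ> \<gamma>)"
    using valid_path_compose_holomorphic[OF \<gamma>(1) \<psi>W W(1)] im by auto
  have base: "contour_integral (\<psi> \<circ> \<gamma>) g = 2 * of_real pi * \<i> * residue (\<lambda>t. g (\<psi> t) * deriv \<psi> t) 0"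
    if g: "g holomorphic_on ball 0 \<rho> - {0}" for g
  proof -
    have "(\<lambda>t. (g \<circ> \<psi>) t * deriv \<psi> t) holomorphic_on W - {0}"
      using nz W by (intro holomorphic_intros holomorphic_on_compose_gen[OF _ g]
          holomorphic_on_subset[OF \<psi>W] holomorphic_on_subset[OF holomorphic_deriv[OF \<psi>W W(1)]]) auto
    then have "(\<lambda>t. g (\<psi> t) * deriv \<psi> t) holomorphic_on W - {0}" by (simp add: o_def)
    then have "((\<lambda>t. g (\<psi> t) * deriv \<psi> t) has_contour_integral
        2 * of_real pi * \<i> * residue (\<lambda>t. g (\<psi> t) * deriv \<psi> t) 0) \<gamma>"
      using base_residue[OF W(1,2) r(1) _ W(5)] by (simp add: \<gamma>_def)
    then show ?thesis
      using contour_integral_comp_analyticW[OF an \<gamma>(1), of g] im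
      by (simp add: contour_integral_unique mult.commute subset_Diff_insert)
  qed
  \<comment> \<open>Next, the winding number of the image of the circle, as the residue of the logarithmic derivative.\<close>
  have der0: "deriv \<psi> 0 \<noteq> 0"
    using holomorphic_injective_imp_regular[OF \<psi>(1) S(1) \<psi>(2) S(2)] .
  have "residue (\<lambda>t. (1 / \<psi> t) * deriv \<psi> t) 0 = 1"
  proof (rule residue_simple'[OF W(1,2)])
    show "(\<lambda>t. (1 / \<psi> t) * deriv \<psi> t) holomorphic_on W - {0}"
      using nz by (intro holomorphic_intros holomorphic_on_subset[OF \<psi>W]
         holomorphic_on_subset[OF holomorphic_deriv[OF \<psi>W W(1)]]) auto
    have "((\<lambda>w. \<psi> w / w) \<longlongrightarrow> deriv \<psi> 0) (at 0)"
      using holomorphic_derivI[OF \<psi>W W(1,2)] \<psi>(3) by (simp add: has_field_derivative_iff)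
    moreover have "deriv \<psi> \<midarrow>0\<rightarrow> deriv \<psi> 0"
      using holomorphic_deriv[OF \<psi>W W(1)] W(1,2)
      by (metis holomorphic_on_imp_continuous_on continuous_on_eq_continuous_at isCont_def)
    ultimately have "((\<lambda>w. deriv \<psi> w / (\<psi> w / w)) \<longlongrightarrow> deriv \<psi> 0 / deriv \<psi> 0) (at 0)"
      using der0 by (intro tendsto_divide)
    then show "((\<lambda>w. 1 / \<psi> w * deriv \<psi> w * (w - 0)) \<longlongrightarrow> 1) (at 0)"
      using der0 by (simp add: field_simps)
  qed
  moreover have pim: "path_image (\<psi> \<circ> \<gamma>) \<subseteq> ball 0 \<rho> - {0}"
    using im W(4) nz unfolding path_image_compose by fast
  moreover have "(\<lambda>w. 1 / w) holomorphic_on ball 0 \<rho> - {0}" by (intro holomorphic_intros) auto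
  moreover have "0 \<notin> path_image (\<psi> \<circ> \<gamma>)" using pim by auto
  ultimately have wind: "winding_number (\<psi> \<circ> \<gamma>) 0 = 1"
    using winding_number_valid_path[OF vp, of 0] base[of "\<lambda>w. 1 / w"] by simp
  have "contour_integral (\<psi> \<circ> \<gamma>) H = 2 * pi * \<i> * (\<Sum>p\<in>{0}. winding_number (\<psi> \<circ> \<gamma>) p * residue H p)"
  proof (rule Residue_theorem[of "ball 0 \<rho>"])
    show "H holomorphic_on ball 0 \<rho> - {0}" using H \<rho>(2) by (auto elim: holomorphic_on_subset)
    show "\<forall>z. z \<notin> ball 0 \<rho> \<longrightarrow> winding_number (\<psi> \<circ> \<gamma>) z = 0"
      using pim vp \<gamma>(2) by (intro allI impI winding_number_zero_outside[of _ "ball 0 \<rho>"])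
        (auto simp: valid_path_imp_path pathstart_compose pathfinish_compose)
  qed (use vp \<gamma>(2) pim in \<open>auto simp: pathstart_compose pathfinish_compose\<close>)
  moreover have "H holomorphic_on ball 0 \<rho> - {0}" using H \<rho>(2) by (auto elim: holomorphic_on_subset)
  ultimately show ?thesis using wind base[of H] by simp
qed

text \<open>
  The real coordinates of a point with respect to the basis \<open>1, \<tau>\<close> of \<open>\<complex>\<close>.
\<close>

definition lat_y :: "complex \<Rightarrow> complex \<Rightarrow> real" where
  "lat_y \<tau> z = Im z / Im \<tau>"

definition lat_x :: "complex \<Rightarrow> complex \<Rightarrow> real" where
  "lat_x \<tau> z = Re z - Im z / Im \<tau> * Re \<tau>"

lemma lat_add: "lat_x \<tau> (z + w) = lat_x \<tau> z + lat_x \<tau> w" "lat_y \<tau> (z + w) = lat_y \<tau> z + lat_y \<tau> w"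
  by (auto simp: lat_x_def lat_y_def add_divide_distrib algebra_simps)

lemma lat_of_real:
  assumes "Im \<tau> \<noteq> 0"
  shows "lat_x \<tau> (of_real x + of_real y * \<tau>) = x" "lat_y \<tau> (of_real x + of_real y * \<tau>) = y"
  using assms by (auto simp: lat_x_def lat_y_def)

lemma lat_of_int:
  assumes "Im \<tau> \<noteq> 0"
  shows "lat_x \<tau> (of_int k + of_int l * \<tau>) = k" "lat_y \<tau> (of_int k + of_int l * \<tau>) = l"
  using assms by (auto simp: lat_x_def lat_y_def)

lemma lat_eqI:
  assumes "Im \<tau> \<noteq> 0" "lat_x \<tau> z = lat_x \<tau> w" "lat_y \<tau> z = lat_y \<tau> w"
  shows "z = w"
  using assms by (auto simp: lat_x_def lat_y_def complex_eq_iff)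

lemma convex_lat:
  "convex {z. lat_x \<tau> z < a}" "convex {z. a < lat_x \<tau> z}" "convex {z. lat_x \<tau> z = a}"
  "convex {z. lat_y \<tau> z < a}" "convex {z. a < lat_y \<tau> z}" "convex {z. lat_y \<tau> z = a}"
proof -
  have "lat_x \<tau> z = inner (Complex 1 (- Re \<tau> / Im \<tau>)) z" "lat_y \<tau> z = inner (Complex 0 (1 / Im \<tau>)) z" for z
    by (auto simp: lat_x_def lat_y_def inner_complex_def)
  then show "convex {z. lat_x \<tau> z < a}" "convex {z. a < lat_x \<tau> z}" "convex {z. lat_x \<tau> z = a}"
    "convex {z. lat_y \<tau> z < a}" "convex {z. a < lat_y \<tau> z}" "convex {z. lat_y \<tau> z = a}"
    by (simp_all add: convex_halfspace_lt convex_halfspace_gt convex_hyperplane)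
qed

definition period_lattice :: "complex \<Rightarrow> complex set" where
  "period_lattice \<tau> = {of_int k + of_int l * \<tau> | k l. True}"

lemma contour_integral_linepath_translate:
  "contour_integral (linepath (a + c) (b + c)) f = contour_integral (linepath a b) (\<lambda>z. f (z + c))"
proof -
  have "linepath (a + c) (b + c) = (+) c \<circ> linepath a b"
    by (auto simp: linepath_def fun_eq_iff algebra_simps)
  then show ?thesis by (simp add: contour_integral_translate)
qed

text \<open>
  The period parallelogram centered at \<open>0\<close> contains no other lattice point. Its sides parallel to \<open>\<tau>\<close>
  cancel by \<open>1\<close>-periodicity, and the other two sides, which differ by the
  translation by \<open>\<tau>\<close>, leave \<open>- c\<close>.
\<close>

lemma residue_quasi_periodic:
  assumes \<tau>: "0 < Im \<tau>"
    and hol: "H holomorphic_on - period_lattice \<tau>"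
    and per1: "\<And>z. z \<notin> period_lattice \<tau> \<Longrightarrow> H (z + 1) = H z"
    and per2: "\<And>z. z \<notin> period_lattice \<tau> \<Longrightarrow> H (z + \<tau>) = H z + c"
  shows "residue H 0 = - c / (2 * of_real pi * \<i>)"
proof -
  note im0 = less_imp_neq[OF \<tau>, symmetric]
  define S where "S = {z. lat_x \<tau> z < 3 / 4} \<inter> {z. - 3 / 4 < lat_x \<tau> z} \<inter> {z. lat_y \<tau> z < 3 / 4} \<inter> {z. - 3 / 4 < lat_y \<tau> z}"
  have convS: "convex S" unfolding S_def by (intro convex_Int convex_lat)
  have openS: "open S"
    unfolding S_def lat_x_def lat_y_def
    by (intro open_Int open_Collect_less continuous_intros) (use \<tau> in auto)
  have lattice_S: "z = 0" if z: "z \<in> S" "z \<in> period_lattice \<tau>" for z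
  proof -
    obtain k l where "z = of_int k + of_int l * \<tau>" using z(2) by (auto simp: period_lattice_def)
    with z(1) have "\<bar>real_of_int k\<bar> < 1" "\<bar>real_of_int l\<bar> < 1"
      using z(1) lat_of_int[OF im0, of k l] by (auto simp: S_def)
    then have "k = 0" "l = 0" by linarith+
    with \<open>z = of_int k + of_int l * \<tau>\<close> show ?thesis by simp
  qed
  have zero: "0 \<in> period_lattice \<tau>" unfolding period_lattice_def by (auto intro!: exI[of _ 0])
  have holS: "H holomorphic_on S - {0}"
    using hol by (rule holomorphic_on_subset) (use lattice_S in auto)
  define P where "P = (\<lambda>x y. complex_of_real x + of_real y * \<tau>)"
  define A where "A = P (-1/2) (-1/2)"
  have A1: "A + 1 = P (1/2) (-1/2)" and At: "A + \<tau> = P (-1/2) (1/2)" and A1t: "A + 1 + \<tau> = P (1/2) (1/2)"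
    by (auto simp: A_def P_def algebra_simps)
  have PS: "P x y \<in> S" if "\<bar>x\<bar> \<le> 1/2" "\<bar>y\<bar> \<le> 1/2" for x y
    using that by (auto simp: S_def P_def lat_of_real[OF im0])
  have side: "closed_segment (P x y) (P x' y') \<subseteq> S - {0}"
    if "\<bar>x\<bar> = 1/2" "\<bar>y\<bar> = 1/2" "\<bar>x'\<bar> = 1/2" "\<bar>y'\<bar> = 1/2" "x = x' \<or> y = y'" for x y x' y'
  proof -
    have "closed_segment (P x y) (P x' y') \<subseteq> S"
      using that by (intro closed_segment_subset PS convS) auto
    moreover have "0 \<notin> closed_segment (P x y) (P x' y')"
    proof (cases "x = x'")
      case True
      then have "closed_segment (P x y) (P x' y') \<subseteq> {z. lat_x \<tau> z = x}"
        by (intro closed_segment_subset convex_lat) (auto simp: P_def lat_of_real[OF im0])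
      then show ?thesis using that by (auto simp: lat_x_def)
    next
      case False
      then have "y = y'" using that by auto
      then have "closed_segment (P x y) (P x' y') \<subseteq> {z. lat_y \<tau> z = y}"
        by (intro closed_segment_subset convex_lat) (auto simp: P_def lat_of_real[OF im0])
      then show ?thesis using that by (auto simp: lat_y_def)
    qed
    ultimately show ?thesis by auto
  qed
  have sides: "closed_segment A (A + 1) \<subseteq> S - {0}" "closed_segment (A + 1) (A + 1 + \<tau>) \<subseteq> S - {0}"
     "closed_segment (A + 1 + \<tau>) (A + \<tau>) \<subseteq> S - {0}" "closed_segment (A + \<tau>) A \<subseteq> S - {0}"
    unfolding A1t unfolding At unfolding A1 unfolding A_def by (intro side; simp)+
  have integrable: "H contour_integrable_on linepath a b" if "closed_segment a b \<subseteq> S - {0}" for a b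
    using that holS holomorphic_on_subset
    by (intro contour_integrable_holomorphic_simple[of _ "S - {0}"]) (auto simp: openS open_delete)
  define \<gamma> where "\<gamma> = linepath A (A + 1) +++ linepath (A + 1) (A + 1 + \<tau>) +++
     linepath (A + 1 + \<tau>) (A + \<tau>) +++ linepath (A + \<tau>) A"
  have \<gamma>: "valid_path \<gamma>" "pathfinish \<gamma> = pathstart \<gamma>" by (auto simp: \<gamma>_def intro!: valid_path_join)
  have im: "path_image \<gamma> \<subseteq> S - {0}"
    unfolding \<gamma>_def using sides by (auto simp: path_image_join)
  have off: "z \<notin> period_lattice \<tau>" if "z \<in> S - {0}" for z using lattice_S that by auto
  have "contour_integral \<gamma> H = contour_integral (linepath A (A + 1)) H + contour_integral (linepath (A + 1) (A + 1 + \<tau>)) H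
     + contour_integral (linepath (A + 1 + \<tau>) (A + \<tau>)) H + contour_integral (linepath (A + \<tau>) A) H"
    unfolding \<gamma>_def using integrable[OF sides(1)] integrable[OF sides(2)] integrable[OF sides(3)] integrable[OF sides(4)]
    by (simp add: valid_path_join)
  also have "contour_integral (linepath (A + 1) (A + 1 + \<tau>)) H = contour_integral (linepath A (A + \<tau>)) H"
  proof -
    have "contour_integral (linepath (A + 1) (A + \<tau> + 1)) H = contour_integral (linepath A (A + \<tau>)) (\<lambda>z. H (z + 1))"
      by (rule contour_integral_linepath_translate)
    also have "\<dots> = contour_integral (linepath A (A + \<tau>)) H"
      using off sides(4) by (intro contour_integral_cong per1) (auto simp: closed_segment_commute)
    finally show ?thesis by (simp add: algebra_simps)
  qed
  also have "contour_integral (linepath (A + \<tau>) A) H = - contour_integral (linepath A (A + \<tau>)) H"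
    using contour_integral_reverse_linepath sides(4) holS
    by (metis holomorphic_on_imp_continuous_on continuous_on_subset)
  also have "contour_integral (linepath (A + 1 + \<tau>) (A + \<tau>)) H = - contour_integral (linepath (A + \<tau>) (A + 1 + \<tau>)) H"
    using contour_integral_reverse_linepath sides(3) holS
    by (metis holomorphic_on_imp_continuous_on continuous_on_subset)
  also have "contour_integral (linepath (A + \<tau>) (A + 1 + \<tau>)) H = contour_integral (linepath A (A + 1)) H + c"
  proof -
    have "contour_integral (linepath (A + \<tau>) (A + 1 + \<tau>)) H = contour_integral (linepath A (A + 1)) (\<lambda>z. H (z + \<tau>))"
      by (rule contour_integral_linepath_translate)
    also have "\<dots> = contour_integral (linepath A (A + 1)) (\<lambda>z. H z + c)"
      using off sides(1) by (intro contour_integral_cong per2) auto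
    also have "\<dots> = contour_integral (linepath A (A + 1)) H + contour_integral (linepath A (A + 1)) (\<lambda>z. c)"
      by (rule contour_integral_add[OF integrable[OF sides(1)]
            has_contour_integral_integrable[OF has_contour_integral_const_linepath]])
    finally show ?thesis by simp
  qed
  finally have int: "contour_integral \<gamma> H = - c" by simp
  \<comment> \<open>Each side winds by a positive amount less than one half, so the integral sum lies strictly between 0 and 2.\<close>
  have wind: "winding_number \<gamma> 0 = 1"
  proof -
    have z: "0 \<notin> closed_segment A (A + 1)" "0 \<notin> closed_segment (A + 1) (A + 1 + \<tau>)"
      "0 \<notin> closed_segment (A + 1 + \<tau>) (A + \<tau>)" "0 \<notin> closed_segment (A + \<tau>) A"
      using sides by auto
    have eq: "winding_number \<gamma> 0 = winding_number (linepath A (A + 1)) 0 + winding_number (linepath (A + 1) (A + 1 + \<tau>)) 0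
      + winding_number (linepath (A + 1 + \<tau>) (A + \<tau>)) 0 + winding_number (linepath (A + \<tau>) A) 0"
      unfolding \<gamma>_def using z by (simp add: winding_number_join path_image_join)
    have "0 < Re (winding_number (linepath A (A + 1)) 0)" "0 < Re (winding_number (linepath (A + 1) (A + 1 + \<tau>)) 0)"
       "0 < Re (winding_number (linepath (A + 1 + \<tau>) (A + \<tau>)) 0)" "0 < Re (winding_number (linepath (A + \<tau>) A) 0)"
      using \<tau> by (auto intro!: winding_number_linepath_pos_lt simp: A_def P_def algebra_simps)
    moreover have "Re (winding_number (linepath A (A + 1)) 0) < 1/2" "Re (winding_number (linepath (A + 1) (A + 1 + \<tau>)) 0) < 1/2"
       "Re (winding_number (linepath (A + 1 + \<tau>) (A + \<tau>)) 0) < 1/2" "Re (winding_number (linepath (A + \<tau>) A) 0) < 1/2"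
      using z[THEN winding_number_lt_half_linepath] by (auto simp: abs_less_iff)
    ultimately have "0 < Re (winding_number \<gamma> 0)" "Re (winding_number \<gamma> 0) < 2" unfolding eq by simp_all
    moreover have "winding_number \<gamma> 0 \<in> \<int>"
      using im \<gamma> by (intro integer_winding_number) (auto simp: valid_path_imp_path)
    then obtain n where "winding_number \<gamma> 0 = of_int n" by (auto elim: Ints_cases)
    ultimately show ?thesis by auto
  qed
  have "contour_integral \<gamma> H = 2 * pi * \<i> * (\<Sum>p\<in>{0}. winding_number \<gamma> p * residue H p)"
  proof (rule Residue_theorem[OF openS])
    show "\<forall>z. z \<notin> S \<longrightarrow> winding_number \<gamma> z = 0"
      using im \<gamma> convS by (intro allI impI winding_number_zero_outside[of _ S]) (auto simp: valid_path_imp_path)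
  qed (use \<gamma> im holS convS convex_connected in auto)
  then show ?thesis using int wind by (simp add: field_simps)
qed

section \<open>The Schwarzian derivative in one variable\<close>

text \<open>
  The iterated derivative with exponent \<open>1\<close> is kept so that the formula is literally that of
  \<^const>\<open>schwarzian\<close> on one fiber.
\<close>

definition schwarz :: "(complex \<Rightarrow> complex) \<Rightarrow> complex \<Rightarrow> complex" where
  "schwarz f z = (deriv ^^ 3) f z / (deriv ^^ 1) f z - 3 / 2 * ((deriv ^^ 2) f z / (deriv ^^ 1) f z)\<^sup>2"

lemma schwarz_cong:
  assumes "eventually (\<lambda>z. f z = g z) (nhds z0)"
  shows "schwarz f z0 = schwarz g z0"
  unfolding schwarz_def by (simp only: higher_deriv_cong_ev[OF assms refl])

lemma schwarz_compose:
  assumes G: "G holomorphic_on S" "open S" "z0 \<in> S" and A: "A holomorphic_on T" "open T" "G ` S \<subseteq> T"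
    and nz: "deriv G z0 \<noteq> 0" "deriv A (G z0) \<noteq> 0"
  shows "schwarz (\<lambda>z. A (G z)) z0 = schwarz A (G z0) * (deriv G z0)\<^sup>2 + schwarz G z0"
proof -
  define G1 where "G1 = deriv G" define G2 where "G2 = deriv G1" define G3 where "G3 = deriv G2"
  define A1 where "A1 = deriv A" define A2 where "A2 = deriv A1" define A3 where "A3 = deriv A2"
  have holG: "G1 holomorphic_on S" "G2 holomorphic_on S"
    unfolding G1_def G2_def by (intro holomorphic_deriv G)+
  have holA: "A1 holomorphic_on T" "A2 holomorphic_on T"
    unfolding A1_def A2_def by (intro holomorphic_deriv A)+
  have DG: "(G has_field_derivative G1 z) (at z)" "(G1 has_field_derivative G2 z) (at z)"
     "(G2 has_field_derivative G3 z) (at z)" if "z \<in> S" for z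
    unfolding G3_def using holomorphic_derivI[OF G(1,2) that] holomorphic_derivI[OF holG(1) G(2) that]
      holomorphic_derivI[OF holG(2) G(2) that] by (auto simp: G1_def G2_def)
  have DA: "(A has_field_derivative A1 z) (at z)" "(A1 has_field_derivative A2 z) (at z)"
     "(A2 has_field_derivative A3 z) (at z)" if "z \<in> T" for z
    unfolding A3_def using holomorphic_derivI[OF A(1,2) that] holomorphic_derivI[OF holA(1) A(2) that]
      holomorphic_derivI[OF holA(2) A(2) that] by (auto simp: A1_def A2_def)
  have DAG: "((\<lambda>z. A (G z)) has_field_derivative A1 (G z) * G1 z) (at z)"
    "((\<lambda>z. A1 (G z)) has_field_derivative A2 (G z) * G1 z) (at z)"
    "((\<lambda>z. A2 (G z)) has_field_derivative A3 (G z) * G1 z) (at z)" if "z \<in> S" for z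
    using DA[of "G z"] DG(1)[OF that] A(3) that by (auto intro: DERIV_chain2)
  have ev: "eventually (\<lambda>z. z \<in> S) (nhds z0)" using G by (simp add: eventually_nhds_in_open)
  have d1: "deriv (\<lambda>z. A (G z)) z = A1 (G z) * G1 z" if "z \<in> S" for z
    using DAG(1)[OF that] by (rule DERIV_imp_deriv)
  have d2: "deriv (deriv (\<lambda>z. A (G z))) z = A2 (G z) * (G1 z)\<^sup>2 + A1 (G z) * G2 z" if z: "z \<in> S" for z
  proof -
    have "deriv (deriv (\<lambda>z. A (G z))) z = deriv (\<lambda>z. A1 (G z) * G1 z) z"
      using d1 by (intro deriv_cong_ev eventually_mono[OF eventually_nhds_in_open[OF G(2) z]]) auto
    also have "\<dots> = A2 (G z) * (G1 z)\<^sup>2 + A1 (G z) * G2 z"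
      by (rule DERIV_imp_deriv, (rule derivative_eq_intros DAG DG z refl)+)
         (auto simp: power2_eq_square algebra_simps)
    finally show ?thesis .
  qed
  have d3: "deriv (deriv (deriv (\<lambda>z. A (G z)))) z0 =
      A3 (G z0) * G1 z0 ^ 3 + 3 * A2 (G z0) * G1 z0 * G2 z0 + A1 (G z0) * G3 z0"
  proof -
    have "deriv (deriv (deriv (\<lambda>z. A (G z)))) z0 = deriv (\<lambda>z. A2 (G z) * (G1 z)\<^sup>2 + A1 (G z) * G2 z) z0"
      using d2 by (intro deriv_cong_ev eventually_mono[OF ev]) auto
    also have "\<dots> = A3 (G z0) * G1 z0 ^ 3 + 3 * A2 (G z0) * G1 z0 * G2 z0 + A1 (G z0) * G3 z0"
      by (rule DERIV_imp_deriv, (rule derivative_eq_intros DAG DG G refl)+)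
         (auto simp: power2_eq_square power3_eq_cube algebra_simps)
    finally show ?thesis .
  qed
  have "G1 z0 \<noteq> 0" "A1 (G z0) \<noteq> 0" using nz by (auto simp: G1_def A1_def)
  then show ?thesis
    unfolding schwarz_def numeral_3_eq_3 numeral_2_eq_2 
    using d1[OF G(3)] d2[OF G(3)] d3
    by (simp add: G3_def[symmetric] A3_def[symmetric] flip: G1_def G2_def A1_def A2_def)
       (simp add: field_simps power2_eq_square power3_eq_cube)
qed

lemma schwarz_exp:
  assumes "a \<noteq> 0"
  shows "schwarz (\<lambda>z. exp (a * z)) z0 = - a\<^sup>2 / 2"
proof -
  have "(deriv ^^ n) (\<lambda>z. exp (a * z)) = (\<lambda>z. a ^ n * exp (a * z))" for n
  proof (induction n)
    case (Suc n)
    have "deriv (\<lambda>z. a ^ n * exp (a * z)) z = a ^ Suc n * exp (a * z)" for z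
      by (rule DERIV_imp_deriv) (auto intro!: derivative_eq_intros)
    then show ?case using Suc by auto
  qed auto
  then show ?thesis using assms unfolding schwarz_def
    by (simp only:) (simp add: field_simps power2_eq_square power3_eq_cube)
qed

section \<open>Holomorphic functions on the product with the base\<close>

lemma linear_vector_smult: "linear (\<lambda>s::complex. s *s (v :: complex^'n))"
  by (rule linearI) (auto simp: vec_eq_iff algebra_simps)

lemma continuous_vector_smult [continuous_intros]:
  fixes v :: "complex^'n"
  assumes "continuous_on S f"
  shows "continuous_on S (\<lambda>x. f x *s v)"
  using continuous_on_compose2[OF linear_continuous_on[OF linear_vector_smult[of v, unfolded linear_conv_bounded_linear], of UNIV] assms]
  by simp

lemma holo_tot_continuous_on:
  fixes f :: "complex \<times> (complex^'n) \<Rightarrow> complex"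
  shows "holo_tot f S \<Longrightarrow> continuous_on S f"
  unfolding holo_wrt_def
  by (meson continuous_at_imp_continuous_on has_derivative_continuous)

lemma holo_tot_line:
  fixes f :: "complex \<times> (complex^'n) \<Rightarrow> complex"
  assumes "holo_tot f S" "(z + s * a, b + s *s v) \<in> S"
  shows "(\<lambda>s. f (z + s * a, b + s *s v)) field_differentiable at s"
proof -
  obtain D where D: "(f has_derivative D) (at (z + s * a, b + s *s v))"
      and lin: "\<And>c x. D (case x of (z, b) \<Rightarrow> (c * z, c *s b)) = c * D x"
    using assms unfolding holo_wrt_def by blast
  have "((\<lambda>s. (z + s * a, b + s *s v)) has_derivative (\<lambda>h. (h * a, h *s v))) (at s)"
    by (auto intro!: derivative_eq_intros bounded_linear_imp_has_derivative
        simp: linear_vector_smult linear_conv_bounded_linear[symmetric])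
  from has_derivative_compose[OF this D]
  have "((\<lambda>s. f (z + s * a, b + s *s v)) has_derivative (\<lambda>h. D (h * a, h *s v))) (at s)" .
  moreover have "(\<lambda>h. D (h * a, h *s v)) = (*) (D (a, v))"
    using lin[of _ "(a, v)"] by (auto simp: mult.commute)
  ultimately show ?thesis
    unfolding field_differentiable_def has_field_derivative_def by auto
qed

lemma holo_tot_fiber:
  fixes f :: "complex \<times> (complex^'n) \<Rightarrow> complex"
  assumes "holo_tot f S" "(z, b) \<in> S"
  shows "(\<lambda>z. f (z, b)) field_differentiable at z"
  using holo_tot_line[OF assms(1), of 0 z 1 b 0] assms(2) by simp

lemma holo_tot_param:
  fixes f :: "complex \<times> (complex^'n) \<Rightarrow> complex"
  assumes "holo_tot f S" "(z, b + s *s v) \<in> S"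
  shows "(\<lambda>s. f (z, b + s *s v)) field_differentiable at s"
  using holo_tot_line[OF assms(1), of z s 0 b v] assms(2) by simp

text \<open>
  Holomorphic dependence on a parameter is used twice, with the roles of the fiber variable \<open>z\<close> and the base
  direction \<open>j\<close> exchanged: the first shows that the derivative of a local coordinate along the base has
  no residue, the second lets the coefficient of a jet be differentiated along the base.
\<close>

lemma mixed_derivatives:
  fixes f :: "complex \<times> (complex^'n) \<Rightarrow> complex"
  assumes "open S" "holo_tot f S" "(z0, b) \<in> S"
  obtains r where "0 < r" "(\<lambda>z. partial j (\<lambda>b. f (z, b)) b) holomorphic_on ball z0 r"
    "(\<lambda>s. deriv (\<lambda>z. f (z, b + s *s axis j 1)) z0) field_differentiable at 0"
proof -
  define \<Phi> where "\<Phi> = (\<lambda>x. (fst x :: complex, b + snd x *s axis j 1))"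
  have cont: "continuous_on X \<Phi>" for X
    unfolding \<Phi>_def by (intro continuous_intros)
  have "open (\<Phi> -` S)" using cont assms(1) by (simp add: continuous_on_open_vimage open_vimage)
  moreover have "(z0, 0) \<in> \<Phi> -` S" using assms(3) by (simp add: \<Phi>_def)
  ultimately obtain A B where AB: "open A" "open B" "z0 \<in> A" "0 \<in> B" "A \<times> B \<subseteq> \<Phi> -` S"
    by (metis open_prod_elim mem_Sigma_iff)
  obtain r1 where r1: "0 < r1" "cball z0 r1 \<subseteq> A" using AB by (meson open_contains_cball)
  obtain r2 where r2: "0 < r2" "cball 0 r2 \<subseteq> B" using AB by (meson open_contains_cball)
  define r where "r = min r1 r2"
  have r: "0 < r" "cball z0 r \<times> cball 0 r \<subseteq> \<Phi> -` S" using r1 r2 AB(5) by (auto simp: r_def subset_iff)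
  define F where "F = (\<lambda>z s. f (z, b + s *s axis j 1))"
  have inS: "(z, b + s *s axis j 1) \<in> S" if "z \<in> cball z0 r" "s \<in> cball 0 r" for z s
    using r(2) that by (auto simp: \<Phi>_def subset_iff)
  have "continuous_on (cball z0 r \<times> cball 0 r) (f \<circ> \<Phi>)"
    using r(2) by (intro continuous_on_compose cont continuous_on_subset[OF holo_tot_continuous_on[OF assms(2)]]) auto
  then have cF: "continuous_on (cball z0 r \<times> cball 0 r) (\<lambda>(z, s). F z s)"
    by (simp add: F_def \<Phi>_def o_def case_prod_unfold)
  have swap: "continuous_on (cball 0 r \<times> cball z0 r) ((\<lambda>(z, s). F z s) \<circ> prod.swap)"
    by (intro continuous_on_compose continuous_on_swap) (use cF in \<open>simp add: product_swap\<close>)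
  have hz: "(\<lambda>z. F z s) holomorphic_on ball z0 r" if "s \<in> cball 0 r" for s
    unfolding F_def holomorphic_on_def
    using that inS by (auto intro!: field_differentiable_at_within holo_tot_fiber[OF assms(2)] simp: less_imp_le)
  have hs: "F z holomorphic_on ball 0 r" if "z \<in> cball z0 r" for z
    unfolding F_def holomorphic_on_def
    using that inS by (auto intro!: field_differentiable_at_within holo_tot_param[OF assms(2)] simp: less_imp_le)
  have 1: "(\<lambda>z. deriv (F z) 0) holomorphic_on ball z0 r"
    by (rule partial_deriv_holomorphic_param[OF r(1) cF hz hs]) auto
  have 2: "(\<lambda>s. deriv (\<lambda>z. F z s) z0) holomorphic_on ball 0 r"
    by (rule partial_deriv_holomorphic_param[OF r(1) _ hs hz]) (use swap in \<open>auto simp: o_def case_prod_unfold\<close>)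
  show ?thesis
  proof
    show "0 < r" by fact
    show "(\<lambda>z. partial j (\<lambda>b. f (z, b)) b) holomorphic_on ball z0 r"
      using 1 by (simp add: partial_def F_def)
    show "(\<lambda>s. deriv (\<lambda>z. f (z, b + s *s axis j 1)) z0) field_differentiable at 0"
      using 2 r(1) unfolding F_def holomorphic_on_def by (metis centre_in_ball field_differentiable_within_open open_ball)
  qed
qed

section \<open>Period cells in the universal cover\<close>

lemma period_lattice_iff:
  assumes "Im \<tau> \<noteq> 0"
  shows "z \<in> period_lattice \<tau> \<longleftrightarrow> lat_x \<tau> z \<in> \<int> \<and> lat_y \<tau> z \<in> \<int>"
proof
  assume "lat_x \<tau> z \<in> \<int> \<and> lat_y \<tau> z \<in> \<int>"
  then obtain k l where "lat_x \<tau> z = of_int k" "lat_y \<tau> z = of_int l" by (auto elim!: Ints_cases)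
  then have "z = of_int k + of_int l * \<tau>"
    using assms by (intro lat_eqI[OF assms]) (simp_all add: lat_of_int)
  then show "z \<in> period_lattice \<tau>" by (auto simp: period_lattice_def)
qed (auto simp: period_lattice_def lat_of_int assms)

lemma closed_period_lattice:
  assumes "Im \<tau> \<noteq> 0"
  shows "closed (period_lattice \<tau>)"
proof -
  have "period_lattice \<tau> = lat_x \<tau> -` \<int> \<inter> lat_y \<tau> -` \<int>"
    using period_lattice_iff[OF assms] by auto
  moreover have "continuous_on UNIV (lat_x \<tau>)" "continuous_on UNIV (lat_y \<tau>)"
    unfolding lat_x_def lat_y_def using assms by (auto intro!: continuous_intros)
  ultimately show ?thesis by (auto intro!: closed_Int continuous_closed_vimage simp: continuous_on_eq_continuous_at)
qed

lemma ell_class_eq_iff: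
  "ell_class (z, b) = ell_class (z', b') \<longleftrightarrow> b = b' \<and> z' - z \<in> period_lattice (b $ 1)"
proof
  assume eq: "ell_class (z, b) = ell_class (z', b')"
  have "(z', b') \<in> ell_class (z', b')" unfolding ell_class_def by (auto intro!: exI[of _ 0])
  then have "(z', b') \<in> ell_class (z, b)" using eq by simp
  then show "b = b' \<and> z' - z \<in> period_lattice (b $ 1)"
    unfolding ell_class_def period_lattice_def by (clarsimp simp: add.assoc) blast
next
  assume "b = b' \<and> z' - z \<in> period_lattice (b $ 1)"
  then obtain k l where b: "b' = b" and z: "z' = z + of_int k + of_int l * b $ 1"
    by (auto simp: period_lattice_def algebra_simps)
  have "\<exists>m n. z + of_int i + of_int j * b $ 1 = z' + of_int m + of_int n * b $ 1" for i j
    unfolding z by (rule exI[of _ "i - k"], rule exI[of _ "j - l"]) (simp add: algebra_simps)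
  moreover have "\<exists>m n. z' + of_int i + of_int j * b $ 1 = z + of_int m + of_int n * b $ 1" for i j
    unfolding z by (rule exI[of _ "i + k"], rule exI[of _ "j + l"]) (simp add: algebra_simps)
  ultimately show "ell_class (z, b) = ell_class (z', b')"
    unfolding ell_class_def b by auto
qed

lemma ell_class_translate:
  "ell_class (z + (of_int k + of_int l * b $ 1), b) = ell_class (z, b)"
proof -
  have "z - (z + (of_int k + of_int l * b $ 1)) = of_int (- k) + of_int (- l) * b $ 1"
    by simp
  then show ?thesis unfolding ell_class_eq_iff period_lattice_def by blast
qed

lemma ell_proj_ell_class [simp]: "ell_proj (ell_class (z, b)) = b"
proof -
  have "(z, b) \<in> ell_class (z, b)" unfolding ell_class_def by (auto intro!: exI[of _ 0])
  then have "(SOME x. x \<in> ell_class (z, b)) \<in> ell_class (z, b)" by (rule someI)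
  then show ?thesis unfolding ell_proj_def by (auto simp: ell_class_def)
qed

text \<open>
  Over every point of the base the cell is an open fundamental parallelogram, with center prescribed in
  the coordinates \<open>1, \<tau>\<close>. As the parallelogram moves with \<open>\<tau>\<close>, one cell serves all fibers at once.
\<close>

definition period_cell :: "real \<Rightarrow> real \<Rightarrow> (complex \<times> (complex^2)) set" where
  "period_cell x y = {(z, b). b \<in> ell_base \<and> \<bar>lat_x (b $ 1) z - x\<bar> < 1 / 2 \<and> \<bar>lat_y (b $ 1) z - y\<bar> < 1 / 2}"

lemma open_ell_base: "open ell_base"
proof -
  have "ell_base = {b. 0 < Im (b $ 1)} \<inter> {b. b $ 2 \<noteq> 0}" by (auto simp: ell_base_def)
  moreover have "open {b :: complex^2. 0 < Im (b $ 1)}" "open {b :: complex^2. b $ 2 \<noteq> 0}"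
    by (intro open_Collect_less open_Collect_neq continuous_intros)+
  ultimately show ?thesis by (metis open_Int)
qed

lemma ell_base_Im: "b \<in> ell_base \<Longrightarrow> 0 < Im (b $ 1)"
  by (simp add: ell_base_def)

lemma open_period_cell: "open (period_cell x y)"
proof -
  have base: "open (UNIV \<times> ell_base :: (complex \<times> (complex^2)) set)" by (intro open_Times open_ell_base) auto
  have "continuous_on (UNIV \<times> ell_base) (\<lambda>p. (\<bar>lat_x (snd p $ 1) (fst p) - x\<bar>, \<bar>lat_y (snd p $ 1) (fst p) - y\<bar>))"
    unfolding lat_x_def lat_y_def by (intro continuous_intros) (auto simp: ell_base_def)
  then have "open ((\<lambda>p. (\<bar>lat_x (snd p $ 1) (fst p) - x\<bar>, \<bar>lat_y (snd p $ 1) (fst p) - y\<bar>)) -` ({..<1/2} \<times> {..<1/2}) \<inter> (UNIV \<times> ell_base))"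
    using continuous_on_open_vimage[OF base] open_Times[OF open_lessThan open_lessThan] by blast
  moreover have "(\<lambda>p. (\<bar>lat_x (snd p $ 1) (fst p) - x\<bar>, \<bar>lat_y (snd p $ 1) (fst p) - y\<bar>)) -` ({..<1/2} \<times> {..<1/2}) \<inter> (UNIV \<times> ell_base) = period_cell x y"
    by (auto simp: period_cell_def)
  ultimately show ?thesis by simp
qed

lemma period_cell_diff_lattice:
  fixes b :: "complex^2"
  assumes "(z, b) \<in> period_cell x y" "(z', b) \<in> period_cell x y" "z' - z \<in> period_lattice (b $ 1)"
  shows "z = z'"
proof -
  have im: "Im (b $ 1) \<noteq> 0" using assms(1) by (auto simp: period_cell_def ell_base_def)
  obtain k l where kl: "z' - z = of_int k + of_int l * b $ 1" using assms(3) by (auto simp: period_lattice_def)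
  have z': "z' = z + (z' - z)" by simp
  have "lat_x (b $ 1) z' = lat_x (b $ 1) z + k" "lat_y (b $ 1) z' = lat_y (b $ 1) z + l"
    by (subst z', subst lat_add, subst kl, subst lat_of_int[OF im], rule refl)+
  moreover have "\<bar>lat_x (b $ 1) z - x\<bar> < 1 / 2" "\<bar>lat_y (b $ 1) z - y\<bar> < 1 / 2"
    "\<bar>lat_x (b $ 1) z' - x\<bar> < 1 / 2" "\<bar>lat_y (b $ 1) z' - y\<bar> < 1 / 2"
    using assms(1,2) by (auto simp: period_cell_def)
  ultimately have "\<bar>real_of_int k\<bar> < 1" "\<bar>real_of_int l\<bar> < 1" by linarith+
  then have "k = 0" "l = 0" by linarith+
  then show ?thesis using kl by simp
qed

lemma inj_on_period_cell: "inj_on ell_class (period_cell x y)"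
proof (rule inj_onI, clarify)
  fix z b z' b' assume "(z, b) \<in> period_cell x y" "(z', b') \<in> period_cell x y" "ell_class (z, b) = ell_class (z', b')"
  then show "z = z' \<and> b = b'" using period_cell_diff_lattice[of z b x y z'] by (auto simp: ell_class_eq_iff)
qed

lemma period_cell_subset: "period_cell x y \<subseteq> UNIV \<times> ell_base"
  by (auto simp: period_cell_def)

lemma period_cell_center: "b \<in> ell_base \<Longrightarrow> (z, b) \<in> period_cell (lat_x (b $ 1) z) (lat_y (b $ 1) z)"
  by (auto simp: period_cell_def)

section \<open>Charts on the universal cover\<close>

definition fiber_lift :: "(complex \<times> (complex^2)) set chart \<Rightarrow> complex \<times> (complex^2) \<Rightarrow> complex" where
  "fiber_lift \<kappa> x = snd \<kappa> (ell_class x)"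

definition cover_dom :: "(complex \<times> (complex^2)) set chart \<Rightarrow> (complex \<times> (complex^2)) set" where
  "cover_dom \<kappa> = {x \<in> UNIV \<times> ell_base. ell_class x \<in> fst \<kappa>}"

lemma ell_family_simps [simp]:
  "proj ell_family = ell_proj" "charts ell_family = ell_charts" "base ell_family = ell_base"
  "sect ell_family = (\<lambda>b. ell_class (0, b))" "tot ell_family = ell_class ` (UNIV \<times> ell_base)"
  by (auto simp: ell_family_def)

lemma ell_chartsD:
  assumes "\<kappa> \<in> ell_charts"
  shows "open (cover_dom \<kappa>)" "holo_tot (fiber_lift \<kappa>) (cover_dom \<kappa>)"
    "\<And>p p'. p \<in> fst \<kappa> \<Longrightarrow> p' \<in> fst \<kappa> \<Longrightarrow> ell_proj p = ell_proj p' \<Longrightarrow> snd \<kappa> p = snd \<kappa> p' \<Longrightarrow> p = p'"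
proof -
  obtain D \<eta> where \<kappa>: "\<kappa> = (D, \<eta>)" by (cases \<kappa>)
  have "fiber_lift \<kappa> = \<eta> \<circ> ell_class" by (auto simp: fiber_lift_def \<kappa>)
  then show "open (cover_dom \<kappa>)" "holo_tot (fiber_lift \<kappa>) (cover_dom \<kappa>)"
    "\<And>p p'. p \<in> fst \<kappa> \<Longrightarrow> p' \<in> fst \<kappa> \<Longrightarrow> ell_proj p = ell_proj p' \<Longrightarrow> snd \<kappa> p = snd \<kappa> p' \<Longrightarrow> p = p'"
    using assms unfolding \<kappa> ell_charts_def cover_dom_def by auto
qed

lemma chart_pt_ell:
  assumes "\<kappa> \<in> ell_charts" "p \<in> fst \<kappa>"
  shows "chart_pt ell_family \<kappa> (snd \<kappa> p, ell_proj p) = p"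
  unfolding chart_pt_def
  by (rule inv_into_f_eq) (use assms ell_chartsD(3)[OF assms(1)] in \<open>auto intro!: inj_onI\<close>)

lemma in_chart_fiber_lift:
  assumes "\<kappa> \<in> ell_charts" "(z, b) \<in> cover_dom \<kappa>"
  shows "in_chart ell_family \<kappa> f (fiber_lift \<kappa> (z, b), b) = f (ell_class (z, b))"
  using chart_pt_ell[OF assms(1), of "ell_class (z, b)"] assms(2)
  by (simp add: in_chart_def fiber_lift_def cover_dom_def)

text \<open>
  On one fiber a chart is an injective holomorphic function of \<open>z\<close>, hence has a holomorphic inverse
  \<open>\<psi>\<close>. Every fiberwise computation in the chart becomes one in the variable \<open>z\<close> through \<open>\<psi>\<close>.
\<close>

lemma fiber_chart_inverse:
  assumes \<kappa>: "\<kappa> \<in> ell_charts" "(z0, b) \<in> cover_dom \<kappa>" and Q: "open Q" "z0 \<in> Q"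
  obtains r \<psi> where "0 < r" "ball z0 r \<subseteq> Q" "ball z0 r \<times> {b} \<subseteq> cover_dom \<kappa>"
    "(\<lambda>z. fiber_lift \<kappa> (z, b)) holomorphic_on ball z0 r"
    "inj_on (\<lambda>z. fiber_lift \<kappa> (z, b)) (ball z0 r)"
    "open ((\<lambda>z. fiber_lift \<kappa> (z, b)) ` ball z0 r)"
    "\<psi> holomorphic_on (\<lambda>z. fiber_lift \<kappa> (z, b)) ` ball z0 r"
    "\<And>z. z \<in> ball z0 r \<Longrightarrow> \<psi> (fiber_lift \<kappa> (z, b)) = z"
    "\<And>z. z \<in> ball z0 r \<Longrightarrow> deriv (\<lambda>z. fiber_lift \<kappa> (z, b)) z * deriv \<psi> (fiber_lift \<kappa> (z, b)) = 1"
proof -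
  define N where "N = cover_dom \<kappa> \<inter> period_cell (lat_x (b $ 1) z0) (lat_y (b $ 1) z0) \<inter> (Q \<times> UNIV)"
  have b: "b \<in> ell_base" using \<kappa>(2) by (auto simp: cover_dom_def)
  have "open N" "(z0, b) \<in> N"
    using ell_chartsD(1)[OF \<kappa>(1)] open_period_cell Q \<kappa>(2) period_cell_center[OF b]
    by (auto simp: N_def intro!: open_Times)
  then obtain A B where "open A" "z0 \<in> A" "b \<in> B" "A \<times> B \<subseteq> N" by (metis open_prod_elim mem_Sigma_iff)
  moreover obtain r where r: "0 < r" "ball z0 r \<subseteq> A" using \<open>open A\<close> \<open>z0 \<in> A\<close> openE by blast
  ultimately have sub: "ball z0 r \<times> {b} \<subseteq> N" by blast
  let ?G = "\<lambda>z. fiber_lift \<kappa> (z, b)"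
  have hol: "?G holomorphic_on ball z0 r"
    unfolding holomorphic_on_def using sub
    by (auto intro!: field_differentiable_at_within holo_tot_fiber[OF ell_chartsD(2)[OF \<kappa>(1)]] simp: N_def)
  have inj: "inj_on ?G (ball z0 r)"
  proof (rule inj_onI)
    fix z z' assume z: "z \<in> ball z0 r" "z' \<in> ball z0 r" "?G z = ?G z'"
    then have "(z, b) \<in> N" "(z', b) \<in> N" using sub by auto
    then have "ell_class (z, b) = ell_class (z', b)"
      using z by (intro ell_chartsD(3)[OF \<kappa>(1)]) (auto simp: N_def cover_dom_def fiber_lift_def)
    then show "z = z'"
      using inj_on_period_cell \<open>(z, b) \<in> N\<close> \<open>(z', b) \<in> N\<close> by (auto simp: N_def dest: inj_onD)
  qed
  obtain \<psi> where "\<psi> holomorphic_on ?G ` ball z0 r"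
      "\<And>z. z \<in> ball z0 r \<Longrightarrow> deriv ?G z * deriv \<psi> (?G z) = 1" "\<And>z. z \<in> ball z0 r \<Longrightarrow> \<psi> (?G z) = z"
    using holomorphic_has_inverse[OF hol open_ball inj] by metis
  moreover have "open (?G ` ball z0 r)" using open_mapping_thm3[OF hol open_ball inj] .
  moreover have "ball z0 r \<subseteq> Q" "ball z0 r \<times> {b} \<subseteq> cover_dom \<kappa>" using sub by (auto simp: N_def)
  ultimately show ?thesis using that r(1) hol inj by blast
qed

lemma deriv_fiber_lift_nonzero:
  assumes "\<kappa> \<in> ell_charts" "(z0, b) \<in> cover_dom \<kappa>"
  shows "deriv (\<lambda>z. fiber_lift \<kappa> (z, b)) z0 \<noteq> 0"
proof (rule fiber_chart_inverse[OF assms open_UNIV UNIV_I])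
  fix r and \<psi> :: "complex \<Rightarrow> complex"
  assume "0 < r" and "\<And>z. z \<in> ball z0 r \<Longrightarrow>
    deriv (\<lambda>z. fiber_lift \<kappa> (z, b)) z * deriv \<psi> (fiber_lift \<kappa> (z, b)) = 1"
  from this(2)[of z0] this(1) show ?thesis by auto
qed

section \<open>Schwarzians and projective structures\<close>

lemma fib_deriv_conv:
  assumes "\<psi> holomorphic_on W" "open W" "fiber_lift \<kappa> (z0, b) \<in> W"
    and "\<And>t. t \<in> W \<Longrightarrow> chart_pt ell_family \<kappa> (t, b) = ell_class (\<psi> t, b)"
  shows "fib_deriv ell_family \<kappa> k (snd \<mu>) (ell_class (z0, b)) =
    (deriv ^^ k) (\<lambda>t. fiber_lift \<mu> (\<psi> t, b)) (fiber_lift \<kappa> (z0, b))"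
  unfolding fib_deriv_def
proof (rule higher_deriv_cong_ev)
  show "\<forall>\<^sub>F t in nhds (snd \<kappa> (ell_class (z0, b))).
      in_chart ell_family \<kappa> (snd \<mu>) (t, proj ell_family (ell_class (z0, b))) = fiber_lift \<mu> (\<psi> t, b)"
    using assms by (intro eventually_mono[OF eventually_nhds_in_open[of W]])
      (auto simp: in_chart_def fiber_lift_def)
qed (simp add: fiber_lift_def)

lemma chart_pt_fiber_inverse:
  assumes "\<kappa> \<in> ell_charts" "S \<times> {b} \<subseteq> cover_dom \<kappa>"
    and "\<And>z. z \<in> S \<Longrightarrow> \<psi> (fiber_lift \<kappa> (z, b)) = z"
    and "t \<in> (\<lambda>z. fiber_lift \<kappa> (z, b)) ` S"
  shows "chart_pt ell_family \<kappa> (t, b) = ell_class (\<psi> t, b)"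
proof -
  obtain z where z: "z \<in> S" "t = fiber_lift \<kappa> (z, b)" using assms(4) by auto
  then show ?thesis
    using chart_pt_ell[OF assms(1), of "ell_class (z, b)"] assms(2,3)
    by (auto simp: fiber_lift_def cover_dom_def subset_iff)
qed

text \<open>
  This is the chain rule on one fiber: in the coordinate \<open>z\<close>, the function \<open>\<mu>\<close> is the composition of its
  expression in the chart \<open>\<kappa>\<close> with \<open>\<kappa>\<close>.
\<close>

lemma schwarzian_fiber_lift:
  assumes \<kappa>: "\<kappa> \<in> ell_charts" "(z0, b) \<in> cover_dom \<kappa>" and \<mu>: "\<mu> \<in> ell_charts" "(z0, b) \<in> cover_dom \<mu>"
  shows "schwarz (\<lambda>z. fiber_lift \<mu> (z, b)) z0 =
     schwarzian ell_family \<kappa> (snd \<mu>) (ell_class (z0, b)) * (deriv (\<lambda>z. fiber_lift \<kappa> (z, b)) z0)\<^sup>2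
     + schwarz (\<lambda>z. fiber_lift \<kappa> (z, b)) z0"
proof -
  let ?F = "\<lambda>z. fiber_lift \<mu> (z, b)" and ?G = "\<lambda>z. fiber_lift \<kappa> (z, b)"
  obtain r' where r': "0 < r'" "ball z0 r' \<times> {b} \<subseteq> cover_dom \<mu>" "?F holomorphic_on ball z0 r'"
    by (rule fiber_chart_inverse[OF \<mu> open_UNIV UNIV_I])
  obtain r \<psi> where r: "0 < r" "ball z0 r \<subseteq> ball z0 r'" "ball z0 r \<times> {b} \<subseteq> cover_dom \<kappa>"
    "?G holomorphic_on ball z0 r" "inj_on ?G (ball z0 r)" "open (?G ` ball z0 r)" "\<psi> holomorphic_on ?G ` ball z0 r"
    and inv: "\<And>z. z \<in> ball z0 r \<Longrightarrow> \<psi> (?G z) = z"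
    and der: "\<And>z. z \<in> ball z0 r \<Longrightarrow> deriv ?G z * deriv \<psi> (?G z) = 1"
    by (rule fiber_chart_inverse[OF \<kappa> open_ball, of z0 r']) (use r'(1) in auto)
  define W where "W = ?G ` ball z0 r"
  have z0: "z0 \<in> ball z0 r" and W0: "?G z0 \<in> W" using r(1) by (auto simp: W_def)
  define A where "A = (\<lambda>t. ?F (\<psi> t))"
  have holF: "?F holomorphic_on ball z0 r" using r'(3) r(2) by (rule holomorphic_on_subset)
  have "(?F \<circ> \<psi>) holomorphic_on W"
    unfolding W_def by (rule holomorphic_on_compose_gen[OF r(7) holF]) (use inv in auto)
  then have A: "A holomorphic_on W" by (simp add: A_def o_def)
  have AG: "A (?G z) = ?F z" if "z \<in> ball z0 r" for z using inv[OF that] by (simp add: A_def)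
  have ev: "\<forall>\<^sub>F z in nhds z0. ?F z = A (?G z)"
    using AG by (intro eventually_mono[OF eventually_nhds_in_open[OF open_ball z0]]) auto
  have dG: "(?G has_field_derivative deriv ?G z0) (at z0)"
    using holomorphic_derivI[OF r(4) open_ball z0] .
  have "(A has_field_derivative deriv A (?G z0)) (at (?G z0))"
    using holomorphic_derivI[OF A _ W0] r(6) by (auto simp: W_def)
  from DERIV_chain2[OF this dG] have "deriv (\<lambda>z. A (?G z)) z0 = deriv A (?G z0) * deriv ?G z0"
    by (rule DERIV_imp_deriv)
  moreover have "deriv ?F z0 = deriv (\<lambda>z. A (?G z)) z0" by (rule deriv_cong_ev[OF ev refl])
  ultimately have nz: "deriv A (?G z0) \<noteq> 0" using deriv_fiber_lift_nonzero[OF \<mu>] by auto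
  have sch: "schwarzian ell_family \<kappa> (snd \<mu>) (ell_class (z0, b)) = schwarz A (?G z0)"
    unfolding schwarzian_def schwarz_def A_def
    using fib_deriv_conv[OF r(7,6) W0[unfolded W_def] chart_pt_fiber_inverse[OF \<kappa>(1) r(3) inv]] by simp
  have "schwarz ?F z0 = schwarz (\<lambda>z. A (?G z)) z0" by (rule schwarz_cong[OF ev])
  also have "\<dots> = schwarz A (?G z0) * (deriv ?G z0)\<^sup>2 + schwarz ?G z0"
    using r(6) by (intro schwarz_compose[OF r(4) open_ball z0 A] deriv_fiber_lift_nonzero[OF \<kappa>] nz) (auto simp: W_def)
  finally show ?thesis by (simp add: sch)
qed

definition cell_chart :: "(complex \<times> (complex^2) \<Rightarrow> complex) \<Rightarrow> real \<Rightarrow> real \<Rightarrow> (complex \<times> (complex^2)) set chart" where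
  "cell_chart f x y = (ell_class ` period_cell x y, f \<circ> inv_into (period_cell x y) ell_class)"

definition cell_injective :: "(complex \<times> (complex^2) \<Rightarrow> complex) \<Rightarrow> bool" where
  "cell_injective f \<longleftrightarrow> (\<forall>x y. \<forall>p\<in>period_cell x y. \<forall>q\<in>period_cell x y. snd p = snd q \<and> f p = f q \<longrightarrow> p = q)"

lemma cell_chart_mem:
  assumes "lift_contains P f" "cell_injective f"
  shows "cell_chart f x y \<in> P"
proof -
  have "\<forall>p\<in>period_cell x y. \<forall>q\<in>period_cell x y. snd p = snd q \<and> f p = f q \<longrightarrow> p = q"
    using assms(2) unfolding cell_injective_def by (elim allE)
  with open_period_cell period_cell_subset inj_on_period_cell show ?thesis
    unfolding cell_chart_def by (intro assms(1)[unfolded lift_contains_def, rule_format] conjI)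
qed

lemma cell_chart_cover: "period_cell x y \<subseteq> cover_dom (cell_chart f x y)"
  using period_cell_subset by (auto simp: cover_dom_def cell_chart_def)

lemma cell_chart_fiber_lift: "p \<in> period_cell x y \<Longrightarrow> fiber_lift (cell_chart f x y) p = f p"
  by (simp add: fiber_lift_def cell_chart_def inv_into_f_f inj_on_period_cell)

lemma cell_injective_z: "cell_injective (\<lambda>(z, b). z)"
  by (auto simp: cell_injective_def)

lemma cell_injective_exp: "cell_injective (\<lambda>(z, b). exp (2 * \<i> * of_real pi * z))"
  unfolding cell_injective_def
proof (clarsimp)
  fix x y z z' and b :: "complex^2"
  assume z: "(z, b) \<in> period_cell x y" "(z', b) \<in> period_cell x y"
    and "exp (2 * \<i> * of_real pi * z) = exp (2 * \<i> * of_real pi * z')"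
  then obtain n :: int where "2 * \<i> * of_real pi * z = 2 * \<i> * of_real pi * z' + of_int (2 * n) * of_real pi * \<i>"
    by (auto simp: exp_eq)
  then have "2 * \<i> * of_real pi * (z' - z) = 2 * \<i> * of_real pi * of_int (- n)"
    by (simp add: algebra_simps)
  then have "z' - z = of_int (- n)" by (subst (asm) mult_cancel_left) auto
  also have "\<dots> \<in> period_lattice (b $ 1)"
    unfolding period_lattice_def by (intro CollectI exI[of _ "- n"] exI[of _ 0]) auto
  finally show "z = z'" by (rule period_cell_diff_lattice[OF z])
qed

lemma eventually_fiber:
  assumes "open N" "(z, b) \<in> N"
  shows "\<forall>\<^sub>F t in nhds z. (t, b) \<in> N"
proof -
  obtain A B where "open A" "z \<in> A" "b \<in> B" "A \<times> B \<subseteq> N" by (metis assms open_prod_elim mem_Sigma_iff)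
  then show ?thesis by (auto simp: eventually_nhds)
qed

lemma eventually_base:
  assumes "open N" "(z, b) \<in> N"
  shows "\<forall>\<^sub>F b' in nhds b. (z, b') \<in> N"
proof -
  obtain A B where "open B" "z \<in> A" "b \<in> B" "A \<times> B \<subseteq> N" by (metis assms open_prod_elim mem_Sigma_iff)
  then show ?thesis by (auto simp: eventually_nhds)
qed

text \<open>
  Any member of \<open>P\<close> near the point has vanishing Schwarzian with respect to the cell chart given by
  \<open>f\<close>, so in the coordinate \<open>z\<close> it has the same Schwarzian as \<open>f\<close>. The choice made in
  \<^const>\<open>schwarzian_ps\<close> is therefore immaterial.
\<close>

lemma schwarzian_ps_fiber_lift:
  assumes P: "projective_structure ell_family P" "lift_contains P f" "cell_injective f"
    and \<kappa>: "\<kappa> \<in> ell_charts" "(z0, b) \<in> cover_dom \<kappa>"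
  shows "schwarz (\<lambda>z. f (z, b)) z0 =
     schwarzian_ps ell_family \<kappa> P (ell_class (z0, b)) * (deriv (\<lambda>z. fiber_lift \<kappa> (z, b)) z0)\<^sup>2
     + schwarz (\<lambda>z. fiber_lift \<kappa> (z, b)) z0"
proof -
  define x where "x = lat_x (b $ 1) z0"
  define y where "y = lat_y (b $ 1) z0"
  have b: "b \<in> ell_base" using \<kappa>(2) by (auto simp: cover_dom_def)
  have cell: "(z0, b) \<in> period_cell x y" unfolding x_def y_def by (rule period_cell_center[OF b])
  let ?Z = "cell_chart f x y" and ?p = "ell_class (z0, b)"
  have Z: "?Z \<in> P" by (rule cell_chart_mem[OF P(2,3)])
  have sub: "P \<subseteq> ell_charts" using P(1) by (auto simp: projective_structure_def)
  have Zc: "?p \<in> fst ?Z" using cell by (auto simp: cell_chart_def)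
  define \<mu> where "\<mu> = (SOME \<mu>. \<mu> \<in> P \<and> ?p \<in> fst \<mu>)"
  have "\<mu> \<in> P \<and> ?p \<in> fst \<mu>" unfolding \<mu>_def by (rule someI[of _ ?Z]) (use Z Zc in auto)
  then have \<mu>: "\<mu> \<in> P" "?p \<in> fst \<mu>" by auto
  have \<mu>c: "(z0, b) \<in> cover_dom \<mu>" using \<mu>(2) b by (simp add: cover_dom_def)
  have "schwarzian ell_family ?Z (snd \<mu>) ?p = 0"
  proof -
    have "\<forall>\<kappa>\<in>P. \<forall>\<mu>\<in>P. \<forall>p\<in>fst \<kappa> \<inter> fst \<mu>. schwarzian ell_family \<kappa> (snd \<mu>) p = 0"
      using P(1) unfolding projective_structure_def by (elim conjE)
    from this[rule_format, OF Z \<mu>(1), of ?p] show ?thesis using Zc \<mu>(2) by blast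
  qed
  moreover have "schwarz (\<lambda>z. fiber_lift ?Z (z, b)) z0 = schwarz (\<lambda>z. f (z, b)) z0"
    by (rule schwarz_cong, rule eventually_mono[OF eventually_fiber[OF open_period_cell cell]])
       (simp add: cell_chart_fiber_lift)
  moreover have "schwarz (\<lambda>z. fiber_lift \<mu> (z, b)) z0 =
     schwarzian ell_family ?Z (snd \<mu>) ?p * (deriv (\<lambda>z. fiber_lift ?Z (z, b)) z0)\<^sup>2
     + schwarz (\<lambda>z. fiber_lift ?Z (z, b)) z0"
    by (rule schwarzian_fiber_lift[OF subsetD[OF sub Z] subsetD[OF cell_chart_cover cell] subsetD[OF sub \<mu>(1)] \<mu>c])
  ultimately have F: "schwarz (\<lambda>z. fiber_lift \<mu> (z, b)) z0 = schwarz (\<lambda>z. f (z, b)) z0"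
    by simp
  have ps: "schwarzian_ps ell_family \<kappa> P ?p = schwarzian ell_family \<kappa> (snd \<mu>) ?p"
    by (simp add: schwarzian_ps_def \<mu>_def)
  have "\<mu> \<in> ell_charts" using \<mu>(1) sub by blast
  then show ?thesis unfolding F[symmetric] ps by (rule schwarzian_fiber_lift[OF \<kappa> _ \<mu>c])
qed

section \<open>Lifts of the coordinate vector fields\<close>

lemma vf_apply_coord: "vf_apply (coord_vf i) f b = partial i f b"
proof -
  have "(\<Sum>j\<in>UNIV. coord_vf i j b * partial j f b) = (\<Sum>j\<in>UNIV. if j = i then partial j f b else 0)"
    by (rule sum.cong) (auto simp: coord_vf_def)
  then show ?thesis by (simp add: vf_apply_def)
qed

lemma partial_cong:
  assumes "\<forall>\<^sub>F b' in nhds b. f b' = g b'"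
  shows "partial i f b = partial i g b"
  unfolding partial_def
proof (rule deriv_cong_ev)
  have "continuous_on UNIV (\<lambda>s. b + s *s axis i 1)" by (intro continuous_intros)
  then have "isCont (\<lambda>s. b + s *s axis i 1) 0" by (simp add: continuous_on_eq_continuous_at)
  then have "filterlim (\<lambda>s. b + s *s axis i 1) (nhds (b + 0 *s axis i 1)) (nhds 0)"
    unfolding isCont_def using tendsto_at_iff_tendsto_nhds[of "\<lambda>s. b + s *s axis i 1" 0] by blast
  then have "filterlim (\<lambda>s. b + s *s axis i 1) (nhds b) (nhds 0)" by simp
  then show "\<forall>\<^sub>F s in nhds 0. f (b + s *s axis i 1) = g (b + s *s axis i 1)"
    using assms by (rule eventually_compose_filterlim[rotated])
qed simp

text \<open>
  \<open>H\<close> is the derivative of the coordinate \<open>z\<close> along the lift, glued from the cell charts. Its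
  behaviour under the lattice is the transformation rule of a lift applied to the chart
  \<open>z + k + l\<tau>\<close>, whose derivative in the base direction \<open>i\<close> is \<open>l\<close> if \<open>i\<close> is the direction of \<open>\<tau>\<close>
  and \<open>0\<close> otherwise.
\<close>

lemma ell_lift_residue:
  fixes b :: "complex^2"
  assumes charts: "\<And>x y. cell_chart (\<lambda>(z, b). z) x y \<in> ell_charts"
    and lift: "vf_lift ell_family U (coord_vf i) h"
    and U: "U \<subseteq> ell_base" "b \<in> U"
  obtains H where "H holomorphic_on - period_lattice (b $ 1)"
    "residue H 0 = - (if i = 1 then 1 else 0) / (2 * of_real pi * \<i>)"
    "\<And>\<kappa> z. \<kappa> \<in> ell_charts \<Longrightarrow> (z, b) \<in> cover_dom \<kappa> \<Longrightarrow> z \<notin> period_lattice (b $ 1) \<Longrightarrow>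
       h \<kappa> (ell_class (z, b)) = H z * deriv (\<lambda>z. fiber_lift \<kappa> (z, b)) z
         + partial i (\<lambda>b. fiber_lift \<kappa> (z, b)) b"
proof -
  have b: "b \<in> ell_base" using U by auto
  note im = ell_base_Im[OF b]
  note im0 = less_imp_neq[OF im, symmetric]
  let ?L = "period_lattice (b $ 1)"
  define Z where "Z = (\<lambda>z. cell_chart (\<lambda>(z, b). z) (lat_x (b $ 1) z) (lat_y (b $ 1) z))"
  define C where "C = (\<lambda>z. period_cell (lat_x (b $ 1) z) (lat_y (b $ 1) z))"
  define H where "H = (\<lambda>z. h (Z z) (ell_class (z, b)))"
  have Z: "Z z \<in> ell_charts" for z unfolding Z_def by (rule charts)
  have C: "open (C z)" "(z, b) \<in> C z" "C z \<subseteq> cover_dom (Z z)" for z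
    unfolding C_def Z_def by (rule open_period_cell period_cell_center[OF b] cell_chart_cover)+
  have lift_Z: "fiber_lift (Z z) p = fst p" if "p \<in> C z" for z p
    using cell_chart_fiber_lift[OF that[unfolded C_def], of "\<lambda>(z, b). z"] unfolding Z_def by (cases p) simp
  have in_Z: "in_chart ell_family (Z z) f (t, b') = f (ell_class (t, b'))" if "(t, b') \<in> C z" for z t b' and f :: "_ \<Rightarrow> complex"
    using in_chart_fiber_lift[OF Z subsetD[OF C(3) that], of f] lift_Z[OF that] by simp
  have off: "ell_class (z, b) \<noteq> ell_class (0, b)" if "z \<notin> ?L" for z
  proof
    assume "ell_class (z, b) = ell_class (0, b)"
    from ell_class_eq_iff[THEN iffD1, OF this[symmetric]] that show False by simp
  qed
  have transf: "h \<kappa> (ell_class (z, b)) = H z * deriv (\<lambda>z. fiber_lift \<kappa> (z, b)) z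
         + partial i (\<lambda>b. fiber_lift \<kappa> (z, b)) b"
    if \<kappa>: "\<kappa> \<in> ell_charts" "(z, b) \<in> cover_dom \<kappa>" and z: "z \<notin> ?L" for \<kappa> z
  proof -
    let ?p = "ell_class (z, b)"
    have sndZ: "snd (Z z) ?p = z" using lift_Z[OF C(2)] by (simp add: fiber_lift_def)
    have p: "?p \<in> fst \<kappa> \<inter> fst (Z z)" using \<kappa>(2) subsetD[OF C(3) C(2)] by (simp add: cover_dom_def)
    have "h \<kappa> ?p = h (Z z) ?p * fib_deriv ell_family (Z z) 1 (snd \<kappa>) ?p +
        vf_apply (coord_vf i) (\<lambda>b. in_chart ell_family (Z z) (snd \<kappa>) (snd (Z z) ?p, b)) b"
    proof -
      have "\<forall>\<eta>\<in>ell_charts. \<forall>\<mu>\<in>ell_charts. \<forall>p\<in>fst \<eta> \<inter> fst \<mu>. ell_proj p \<in> U \<and> p \<noteq> ell_class (0, ell_proj p) \<longrightarrow>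
        h \<eta> p = h \<mu> p * fib_deriv ell_family \<mu> 1 (snd \<eta>) p +
                vf_apply (coord_vf i) (\<lambda>b. in_chart ell_family \<mu> (snd \<eta>) (snd \<mu> p, b)) (ell_proj p)"
        using lift unfolding vf_lift_def ell_family_simps by (elim conjE)
      from this[THEN bspec, OF \<kappa>(1), THEN bspec, OF Z, THEN bspec, OF p, THEN mp] U(2) off[OF z]
      show ?thesis unfolding ell_proj_ell_class by blast
    qed
    moreover have "fib_deriv ell_family (Z z) 1 (snd \<kappa>) ?p = deriv (\<lambda>z. fiber_lift \<kappa> (z, b)) z"
    proof -
      have "\<forall>\<^sub>F t in nhds z. in_chart ell_family (Z z) (snd \<kappa>) (t, b) = fiber_lift \<kappa> (t, b)"
        by (rule eventually_mono[OF eventually_fiber[OF C(1)[of z] C(2)[of z]]]) (simp add: in_Z fiber_lift_def)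
      then show ?thesis unfolding fib_deriv_def by (simp add: sndZ deriv_cong_ev)
    qed
    moreover have "vf_apply (coord_vf i) (\<lambda>b. in_chart ell_family (Z z) (snd \<kappa>) (snd (Z z) ?p, b)) b
        = partial i (\<lambda>b. fiber_lift \<kappa> (z, b)) b"
      unfolding vf_apply_coord sndZ
      by (rule partial_cong, rule eventually_mono[OF eventually_base[OF C(1)[of z] C(2)[of z]]]) (simp add: in_Z fiber_lift_def)
    ultimately show ?thesis by (simp add: H_def)
  qed
  \<comment> \<open>The cell charts around the point and around its translate differ by a translation that varies with the base point.\<close>
  have shift: "H (z + (of_int k + of_int l * b $ 1)) = H z + of_int l * (if i = 1 then 1 else 0)"
    if z: "z \<notin> ?L" for z k l
  proof -
    define z' where "z' = z + (of_int k + of_int l * b $ 1)"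
    define T where "T = (\<lambda>p :: complex \<times> (complex^2). (fst p + (of_int k + of_int l * snd p $ 1), snd p))"
    have "continuous_on UNIV T" unfolding T_def by (intro continuous_intros)
    then have "open (T -` C z')" using C(1) by (simp add: open_vimage)
    moreover have "(z, b) \<in> T -` C z'" using C(2)[of z'] by (simp add: T_def z'_def)
    moreover have lift_T: "fiber_lift (Z z') (t, b') = t + (of_int k + of_int l * b' $ 1)" if "(t, b') \<in> T -` C z'" for t b'
      using lift_Z[of "T (t, b')" z'] that ell_class_translate[of t k l b']
      by (simp add: T_def fiber_lift_def)
    ultimately have ev: "\<forall>\<^sub>F t in nhds z. fiber_lift (Z z') (t, b) = t + (of_int k + of_int l * b $ 1)"
       "\<forall>\<^sub>F b' in nhds b. fiber_lift (Z z') (z, b') = z + (of_int k + of_int l * b' $ 1)"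
      by (auto intro: eventually_mono[OF eventually_fiber] eventually_mono[OF eventually_base])
    have p: "ell_class (z', b) = ell_class (z, b)" unfolding z'_def by (rule ell_class_translate)
    have cov: "(z, b) \<in> cover_dom (Z z')" using subsetD[OF C(3) C(2)[of z']] p by (simp add: cover_dom_def)
    have "deriv (\<lambda>t. fiber_lift (Z z') (t, b)) z = deriv (\<lambda>t. t + (of_int k + of_int l * b $ 1)) z"
      by (rule deriv_cong_ev[OF ev(1) refl])
    also have "\<dots> = 1" by (rule DERIV_imp_deriv) (auto intro!: derivative_eq_intros)
    finally have d: "deriv (\<lambda>t. fiber_lift (Z z') (t, b)) z = 1" .
    have "partial i (\<lambda>b'. fiber_lift (Z z') (z, b')) b = partial i (\<lambda>b'. z + (of_int k + of_int l * b' $ 1)) b"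
      by (rule partial_cong[OF ev(2)])
    also have "\<dots> = of_int l * (if i = 1 then 1 else 0)"
      unfolding partial_def by (rule DERIV_imp_deriv) (auto intro!: derivative_eq_intros simp: axis_def)
    finally have d': "partial i (\<lambda>b'. fiber_lift (Z z') (z, b')) b = of_int l * (if i = 1 then 1 else 0)" .
    have "H z' = h (Z z') (ell_class (z, b))" by (simp add: H_def p)
    also have "\<dots> = H z + of_int l * (if i = 1 then 1 else 0)" using transf[OF Z cov z] by (simp add: d d')
    finally show ?thesis by (simp add: z'_def)
  qed
  \<comment> \<open>Locally a single cell chart suffices, and there the lift is a finite sum of holomorphic functions.\<close>
  have hol: "H holomorphic_on - ?L"
  proof -
    have "H field_differentiable at z0" if z0: "z0 \<notin> ?L" for z0
    proof -
      have eqH: "H z = in_chart ell_family (Z z0) (h (Z z0)) (z, b)" if z: "(z, b) \<in> C z0" "z \<notin> ?L" for z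
      proof -
        have "\<forall>\<^sub>F t in nhds z. fiber_lift (Z z0) (t, b) = t"
          by (rule eventually_mono[OF eventually_fiber[OF C(1) z(1)]]) (simp add: lift_Z)
        then have "deriv (\<lambda>t. fiber_lift (Z z0) (t, b)) z = deriv (\<lambda>t. t) z" by (rule deriv_cong_ev[OF _ refl])
        moreover have "\<forall>\<^sub>F b' in nhds b. fiber_lift (Z z0) (z, b') = z"
          by (rule eventually_mono[OF eventually_base[OF C(1) z(1)]]) (simp add: lift_Z)
        then have "partial i (\<lambda>b'. fiber_lift (Z z0) (z, b')) b = partial i (\<lambda>b'. z) b" by (rule partial_cong)
        moreover have "partial i (\<lambda>b'. z) b = 0" by (simp add: partial_def)
        ultimately show ?thesis
          using transf[OF Z subsetD[OF C(3) z(1)] z(2)] in_Z[OF z(1), of "h (Z z0)"] by simp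
      qed
      have p: "ell_class (z0, b) \<in> fst (Z z0)" using subsetD[OF C(3) C(2)[of z0]] by (simp add: cover_dom_def)
      have "\<exists>N E g. open N \<and> (snd (Z z0) (ell_class (z0, b)), b) \<in> N \<and> finite E \<and> (\<forall>e\<in>E. holo_tot (g e) N) \<and>
            (\<forall>y\<in>N. in_chart ell_family (Z z0) (h (Z z0)) y = (\<Sum>e\<in>E. g e y * e))"
      proof -
        have "\<forall>\<eta>\<in>ell_charts. meromorphic_along_sect ell_family U (*) \<eta> (h \<eta>)"
          using lift unfolding vf_lift_def ell_family_simps by (elim conjE)
        from this[THEN bspec, OF Z, unfolded meromorphic_along_sect_def ell_family_simps, THEN bspec, OF p,
            unfolded ell_proj_ell_class, THEN mp, OF U(2), THEN conjunct1, THEN mp, OF off[OF z0]]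
        show ?thesis .
      qed
      moreover have "snd (Z z0) (ell_class (z0, b)) = z0" using lift_Z[OF C(2)] by (simp add: fiber_lift_def)
      ultimately obtain N E g where N: "open N" "(z0, b) \<in> N" "finite E" "\<forall>e\<in>E. holo_tot (g e) N"
        and eqN: "\<forall>y\<in>N. in_chart ell_family (Z z0) (h (Z z0)) y = (\<Sum>e\<in>E. g e y * e)"
        by (elim exE conjE) (simp only:)
      have "\<forall>\<^sub>F z in nhds z0. (z, b) \<in> N \<inter> C z0 \<and> z \<in> - ?L"
        using N(1,2) C(1,2)[of z0] closed_period_lattice[OF im0] z0
        by (intro eventually_conj eventually_fiber eventually_nhds_in_open) auto
      then have ev: "\<forall>\<^sub>F z in nhds z0. H z = (\<Sum>e\<in>E. g e (z, b) * e)"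
        by (rule eventually_mono) (simp add: eqH eqN)
      have "(\<lambda>z. \<Sum>e\<in>E. g e (z, b) * e) field_differentiable at z0"
        by (intro derivative_intros holo_tot_fiber[OF N(4)[THEN bspec] N(2)])
      then obtain D where "((\<lambda>z. \<Sum>e\<in>E. g e (z, b) * e) has_field_derivative D) (at z0)"
        unfolding field_differentiable_def ..
      then have "(H has_field_derivative D) (at z0)" by (rule DERIV_cong_ev[OF refl ev refl, THEN iffD2])
      then show ?thesis unfolding field_differentiable_def ..
    qed
    then show ?thesis unfolding holomorphic_on_def by (simp add: field_differentiable_at_within)
  qed
  have "residue H 0 = - (if i = 1 then 1 else 0) / (2 * of_real pi * \<i>)"
  proof (rule residue_quasi_periodic[OF im hol])
    fix z assume z: "z \<notin> ?L"
    show "H (z + 1) = H z" using shift[OF z, of 1 0] by simp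
    show "H (z + b $ 1) = H z + (if i = 1 then 1 else 0)" using shift[OF z, of 0 1] by simp
  qed
  then show ?thesis by (rule that[OF hol _ transf])
qed

section \<open>Comparison of the two connections\<close>

text \<open>
  In the coordinate \<open>\<kappa>\<close> the jet \<open>a dz\<close> has coefficient \<open>a / (d\<kappa>/dz)\<close>. The term that depends on
  \<open>\<kappa>\<close> is common to all jets and cancels when two of them are compared.
\<close>

lemma log_deriv_ell_jet:
  assumes \<kappa>: "\<kappa> \<in> ell_charts" "(0, b) \<in> cover_dom \<kappa>"
    and a: "(\<lambda>s. a (b + s *s axis i 1)) field_differentiable at 0" "a b \<noteq> 0"
  shows "log_deriv_jet (coord_vf i) (ell_jet a) \<kappa> b =
    partial i (\<lambda>b. deriv (\<lambda>z. fiber_lift \<kappa> (z, b)) 0) b / deriv (\<lambda>z. fiber_lift \<kappa> (z, b)) 0 - partial i a b / a b"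
proof -
  define d where "d = (\<lambda>b. deriv (\<lambda>z. fiber_lift \<kappa> (z, b)) 0)"
  have jet: "1 / ell_jet a \<kappa> b = d b / a b" for b by (simp add: ell_jet_def d_def fiber_lift_def)
  have "(\<lambda>s. d (b + s *s axis i 1)) field_differentiable at 0"
    unfolding d_def by (rule mixed_derivatives[OF ell_chartsD(1,2)[OF \<kappa>(1)] \<kappa>(2), of i])
  then have d: "((\<lambda>s. d (b + s *s axis i 1)) has_field_derivative partial i d b) (at 0)"
    unfolding partial_def by (rule field_differentiable_derivI)
  have a': "((\<lambda>s. a (b + s *s axis i 1)) has_field_derivative partial i a b) (at 0)"
    using a(1) unfolding partial_def by (rule field_differentiable_derivI)
  have "((\<lambda>s. d (b + s *s axis i 1) / a (b + s *s axis i 1)) has_field_derivative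
     (partial i d b * a b - d b * partial i a b) / (a b * a b)) (at 0)"
    using DERIV_divide[OF d a'] a(2) by simp
  then have "partial i (\<lambda>b. d b / a b) b = (partial i d b * a b - d b * partial i a b) / (a b * a b)"
    unfolding partial_def[of i "\<lambda>b. d b / a b"] by (rule DERIV_imp_deriv)
  moreover have "d b \<noteq> 0" unfolding d_def by (rule deriv_fiber_lift_nonzero[OF \<kappa>])
  ultimately have "log_deriv_jet (coord_vf i) (ell_jet a) \<kappa> b = partial i d b / d b - partial i a b / a b"
    using a(2) unfolding log_deriv_jet_def vf_apply_coord jet by (simp add: field_simps)
  then show ?thesis by (simp add: d_def)
qed

text \<open>
  Here \<open>s\<close> and \<open>s'\<close> are the Schwarzians in the coordinate \<open>z\<close> of two projective structures with
  Schwarzians \<open>S\<close> and \<open>S'\<close> in the chart \<open>\<kappa>\<close>. In the difference the Schwarzian of \<open>\<kappa>\<close> itself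
  cancels. What remains of \<open>h (S - S') d\<kappa>\<close> is \<open>(s - s') H dz\<close>, whose residue does not depend on
  the coordinate, and a holomorphic form.
\<close>

lemma residue_lift_difference:
  fixes b :: "complex^2"
  assumes \<kappa>: "\<kappa> \<in> ell_charts" "(0, b) \<in> cover_dom \<kappa>" "fiber_lift \<kappa> (0, b) = 0"
    and H: "H holomorphic_on - period_lattice (b $ 1)"
    and h: "\<And>z. (z, b) \<in> cover_dom \<kappa> \<Longrightarrow> z \<notin> period_lattice (b $ 1) \<Longrightarrow>
       h (ell_class (z, b)) = H z * deriv (\<lambda>z. fiber_lift \<kappa> (z, b)) z
         + partial i (\<lambda>b. fiber_lift \<kappa> (z, b)) b"
    and S: "\<And>z. (z, b) \<in> cover_dom \<kappa> \<Longrightarrow> s = S (ell_class (z, b)) * (deriv (\<lambda>z. fiber_lift \<kappa> (z, b)) z)\<^sup>2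
         + schwarz (\<lambda>z. fiber_lift \<kappa> (z, b)) z"
    and S': "\<And>z. (z, b) \<in> cover_dom \<kappa> \<Longrightarrow> s' = S' (ell_class (z, b)) * (deriv (\<lambda>z. fiber_lift \<kappa> (z, b)) z)\<^sup>2
         + schwarz (\<lambda>z. fiber_lift \<kappa> (z, b)) z"
  shows "residue (\<lambda>t. C * in_chart ell_family \<kappa> h (t, b) * in_chart ell_family \<kappa> S (t, b)) 0
    - residue (\<lambda>t. C * in_chart ell_family \<kappa> h (t, b) * in_chart ell_family \<kappa> S' (t, b)) 0
    = C * (s - s') * residue H 0"
proof -
  let ?L = "period_lattice (b $ 1)" and ?G = "\<lambda>z. fiber_lift \<kappa> (z, b)"
  define K where "K = (\<lambda>z. partial i (\<lambda>b. fiber_lift \<kappa> (z, b)) b)"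
  have b: "b \<in> ell_base" using \<kappa>(2) by (simp add: cover_dom_def)
  obtain r0 where r0: "0 < r0" "K holomorphic_on ball 0 r0"
    unfolding K_def by (rule mixed_derivatives[OF ell_chartsD(1,2)[OF \<kappa>(1)] \<kappa>(2), of i])
  define Q where "Q = ball 0 r0 \<inter> (\<lambda>z. (z, b)) -` period_cell 0 0"
  have "open ((\<lambda>z. (z, b)) -` period_cell 0 0)"
    by (rule open_vimage[OF open_period_cell]) (intro continuous_intros)
  then have "open Q" by (simp add: Q_def open_Int)
  have cell0: "(0, b) \<in> period_cell 0 0" using period_cell_center[OF b, of 0] by (simp add: lat_x_def lat_y_def)
  then have "0 \<in> Q" using r0(1) by (simp add: Q_def)
  obtain r \<psi> where r: "0 < r" "ball 0 r \<subseteq> Q" "ball 0 r \<times> {b} \<subseteq> cover_dom \<kappa>"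
    "?G holomorphic_on ball 0 r" "inj_on ?G (ball 0 r)" "open (?G ` ball 0 r)" "\<psi> holomorphic_on ?G ` ball 0 r"
    and inv: "\<And>z. z \<in> ball 0 r \<Longrightarrow> \<psi> (?G z) = z"
    and der: "\<And>z. z \<in> ball 0 r \<Longrightarrow> deriv ?G z * deriv \<psi> (?G z) = 1"
    by (rule fiber_chart_inverse[OF \<kappa>(1,2) \<open>open Q\<close> \<open>0 \<in> Q\<close>]) blast
  define D where "D = ball (0::complex) r"
  define W where "W = ?G ` D"
  have off: "z \<notin> ?L" if "z \<in> D - {0}" for z
  proof
    assume "z \<in> ?L"
    then have "0 = z"
      using that r(2) by (intro period_cell_diff_lattice[OF cell0]) (auto simp: D_def Q_def)
    then show False using that by auto
  qed
  have D: "open D" "0 \<in> D" using r(1) by (auto simp: D_def)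
  have W: "open W" "0 \<in> W" using r(1,6) \<kappa>(3) by (auto simp: W_def D_def intro!: image_eqI[of _ _ 0])
  have \<psi>: "\<psi> holomorphic_on W" "inj_on \<psi> W" "\<psi> 0 = 0" "\<psi> ` W \<subseteq> D" "\<psi> ` (W - {0}) \<subseteq> D - {0}"
  proof -
    show "\<psi> holomorphic_on W" using r(7) by (simp add: W_def D_def)
    show "inj_on \<psi> W" using inv by (auto simp: W_def D_def intro!: inj_onI)
    show "\<psi> 0 = 0" using inv[of 0] r(1) \<kappa>(3) by simp
    show "\<psi> ` W \<subseteq> D" using inv by (auto simp: W_def D_def)
    show "\<psi> ` (W - {0}) \<subseteq> D - {0}" using inv \<kappa>(3) by (auto simp: W_def D_def)
  qed
  have \<psi>': "deriv \<psi> holomorphic_on W" by (rule holomorphic_deriv[OF \<psi>(1) W(1)])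
  have der\<psi>: "deriv ?G (\<psi> t) * deriv \<psi> t = 1" if "t \<in> W" for t
    using that der inv by (auto simp: W_def D_def)
  have holG: "(deriv ^^ k) ?G holomorphic_on D" for k
    unfolding D_def by (rule holomorphic_higher_deriv[OF r(4) open_ball])
  have "deriv ?G z \<noteq> 0" if "z \<in> D" for z using der[of z] that by (auto simp: D_def)
  then have holS: "schwarz ?G holomorphic_on D"
    unfolding schwarz_def[abs_def] using holG holG[of 0] D(1) by (intro holomorphic_intros) auto
  have holH: "H holomorphic_on D - {0}" using off by (intro holomorphic_on_subset[OF H]) auto
  have holK: "K holomorphic_on D" using r(2) by (intro holomorphic_on_subset[OF r0(2)]) (auto simp: D_def Q_def)
  have comp: "(\<lambda>t. f (\<psi> t)) holomorphic_on W" if "f holomorphic_on D" for f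
    using holomorphic_on_compose_gen[OF \<psi>(1) that \<psi>(4)] by (simp add: o_def)
  have compH: "(\<lambda>t. H (\<psi> t)) holomorphic_on W - {0}"
    using holomorphic_on_compose_gen[OF holomorphic_on_subset[OF \<psi>(1)] holH \<psi>(5)] by (auto simp: o_def)
  note hol0 = holomorphic_on_subset[OF _ Diff_subset, of _ W "{0}"]
  \<comment> \<open>The vector field and the two Schwarzians in the chart, written through the inverse of the chart.\<close>
  define hh where "hh = (\<lambda>t. H (\<psi> t) * deriv ?G (\<psi> t) + K (\<psi> t))"
  define SS where "SS = (\<lambda>c t. (c - schwarz ?G (\<psi> t)) * (deriv \<psi> t)\<^sup>2)"
  have holhh: "hh holomorphic_on W - {0}"
    unfolding hh_def using holG[of 1]
    by (intro holomorphic_on_add holomorphic_on_mult compH hol0[OF comp] holK) simp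
  have holSS: "SS c holomorphic_on W - {0}" for c
    unfolding SS_def by (intro holomorphic_intros hol0[OF comp] hol0[OF \<psi>'] holS)
  have pt: "chart_pt ell_family \<kappa> (t, b) = ell_class (\<psi> t, b)" if "t \<in> W" for t
    using that by (intro chart_pt_fiber_inverse[OF \<kappa>(1) r(3) inv]) (auto simp: W_def D_def)
  have cov: "(\<psi> t, b) \<in> cover_dom \<kappa>" if "t \<in> W" for t
    using r(3) \<psi>(4) that by (auto simp: D_def)
  have h_W: "in_chart ell_family \<kappa> h (t, b) = hh t" if "t \<in> W - {0}" for t
  proof -
    have "\<psi> t \<in> D - {0}" using \<psi>(5) that by blast
    then show ?thesis using that h[OF cov off] by (simp add: in_chart_def pt hh_def K_def)
  qed
  have S_W: "in_chart ell_family \<kappa> R (t, b) = SS c t"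
    if "t \<in> W" and R: "\<And>z. (z, b) \<in> cover_dom \<kappa> \<Longrightarrow> c = R (ell_class (z, b)) * (deriv ?G z)\<^sup>2 + schwarz ?G z" for R c t
  proof -
    have "c - schwarz ?G (\<psi> t) = R (ell_class (\<psi> t, b)) * (deriv ?G (\<psi> t))\<^sup>2"
      using R[OF cov[OF that(1)]] by (simp only: add_diff_cancel_right')
    then have "SS c t = R (ell_class (\<psi> t, b)) * (deriv ?G (\<psi> t) * deriv \<psi> t)\<^sup>2"
      by (simp add: SS_def power_mult_distrib)
    then show ?thesis using that(1) by (simp add: in_chart_def pt der\<psi>)
  qed
  have evW: "eventually (\<lambda>t. t \<in> W - {0}) (at 0)"
    using eventually_at_in_open[OF W] .
  have res: "residue (\<lambda>t. C * in_chart ell_family \<kappa> h (t, b) * in_chart ell_family \<kappa> R (t, b)) 0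
      = residue (\<lambda>t. C * hh t * SS c t) 0"
    if R: "\<And>z. (z, b) \<in> cover_dom \<kappa> \<Longrightarrow> c = R (ell_class (z, b)) * (deriv ?G z)\<^sup>2 + schwarz ?G z" for R c
  proof (rule residue_cong[OF eventually_mono[OF evW] refl])
    fix t assume t: "t \<in> W - {0}"
    show "C * in_chart ell_family \<kappa> h (t, b) * in_chart ell_family \<kappa> R (t, b) = C * hh t * SS c t"
      by (simp only: h_W[OF t] S_W[OF DiffD1[OF t] R])
  qed
  have "residue (\<lambda>t. C * hh t * SS s t) 0 - residue (\<lambda>t. C * hh t * SS s' t) 0
     = residue (\<lambda>t. C * hh t * SS s t - C * hh t * SS s' t) 0"
    by (rule residue_diff[OF W, symmetric]) (intro holomorphic_intros holhh holSS)+
  also have "\<dots> = residue (\<lambda>t. C * (s - s') * (H (\<psi> t) * deriv \<psi> t + K (\<psi> t) * (deriv \<psi> t)\<^sup>2)) 0"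
  proof (rule residue_cong[OF eventually_mono[OF evW] refl])
    fix t assume t: "t \<in> W - {0}"
    have "hh t * (deriv \<psi> t)\<^sup>2 = H (\<psi> t) * (deriv ?G (\<psi> t) * deriv \<psi> t) * deriv \<psi> t + K (\<psi> t) * (deriv \<psi> t)\<^sup>2"
      by (simp add: hh_def power2_eq_square algebra_simps)
    also have "\<dots> = H (\<psi> t) * deriv \<psi> t + K (\<psi> t) * (deriv \<psi> t)\<^sup>2"
      using der\<psi>[of t] t by simp
    finally have "hh t * (deriv \<psi> t)\<^sup>2 = H (\<psi> t) * deriv \<psi> t + K (\<psi> t) * (deriv \<psi> t)\<^sup>2" .
    moreover have "C * hh t * SS s t - C * hh t * SS s' t = C * (s - s') * (hh t * (deriv \<psi> t)\<^sup>2)"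
      by (simp add: SS_def algebra_simps)
    ultimately show "C * hh t * SS s t - C * hh t * SS s' t
        = C * (s - s') * (H (\<psi> t) * deriv \<psi> t + K (\<psi> t) * (deriv \<psi> t)\<^sup>2)" by simp
  qed
  also have "\<dots> = C * (s - s') * residue (\<lambda>t. H (\<psi> t) * deriv \<psi> t + K (\<psi> t) * (deriv \<psi> t)\<^sup>2) 0"
    by (rule residue_lmul[OF W]) (intro holomorphic_intros compH hol0[OF comp] hol0[OF \<psi>'] holK)
  also have "residue (\<lambda>t. H (\<psi> t) * deriv \<psi> t + K (\<psi> t) * (deriv \<psi> t)\<^sup>2) 0
      = residue (\<lambda>t. H (\<psi> t) * deriv \<psi> t) 0 + residue (\<lambda>t. K (\<psi> t) * (deriv \<psi> t)\<^sup>2) 0"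
    by (rule residue_add[OF W]) (intro holomorphic_intros compH hol0[OF comp] hol0[OF \<psi>'] holK)+
  also have "residue (\<lambda>t. K (\<psi> t) * (deriv \<psi> t)\<^sup>2) 0 = 0"
    by (rule residue_holo[OF W]) (intro holomorphic_intros comp \<psi>' holK)
  also have "residue (\<lambda>t. H (\<psi> t) * deriv \<psi> t) 0 = residue H 0"
    by (rule residue_substitution[OF W \<psi>(1-3) D holH])
  finally show ?thesis using res[OF S] res[OF S'] by simp
qed

theorem theorem5p5p1:
  fixes V :: "'v::ab_group_add voa" and M :: "('v, 'w::ab_group_add) vmod"
    and P P' :: "(complex \<times> (complex^2)) set chart set"
    and \<nu> \<nu>' :: "(complex \<times> (complex^2)) set chart \<Rightarrow> complex^2 \<Rightarrow> complex"
    and U U' :: "(complex^2) set"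
    and \<phi> :: "((complex \<times> (complex^2)) set, 2, 'w) dual_family"
    and \<eta> \<mu> :: "(complex \<times> (complex^2)) set chart"
    and h\<^sub>\<tau> h\<^sub>\<zeta> :: "(complex \<times> (complex^2)) set chart \<Rightarrow> (complex \<times> (complex^2)) set \<Rightarrow> complex"
    and b :: "complex^2" and w :: 'w
  assumes "voa V" and "C2_cofinite V" and "rational_voa V"
    and "voa_module V M" and "simple_module M"
    and "projective_structure ell_family P"
    and "lift_contains P (\<lambda>(z, b). z)"
    and "projective_structure ell_family P'"
    and "lift_contains P' (\<lambda>(z, b). exp (2 * \<i> * of_real pi * z))"
    and "\<nu> = ell_jet (\<lambda>b. b $ 2)"
    and "\<nu>' = ell_jet (\<lambda>b. 2 * \<i> * of_real pi)"
    and "open U" and "U \<subseteq> base ell_family"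
    and "conformal_block ell_family V M U \<phi>"
    and "local_coord ell_family U \<eta>"
    and "vf_lift ell_family U (coord_vf 1) h\<^sub>\<tau>"
    and "vf_lift ell_family U (coord_vf 2) h\<^sub>\<zeta>"
    and "open U'" and "U' \<subseteq> U" and "local_coord ell_family U' \<mu>"
    and "b \<in> U'" and "w \<in> mcar M"
  shows "nabla ell_family V M P \<nu> \<eta> (coord_vf 1) h\<^sub>\<tau> \<phi> \<mu> b w =
           nabla ell_family V M P' \<nu>' \<eta> (coord_vf 1) h\<^sub>\<tau> \<phi> \<mu> b w
           + \<i> * ccharge V * of_real pi / 12 * \<phi> \<mu> b w \<and>
         nabla ell_family V M P \<nu> \<eta> (coord_vf 2) h\<^sub>\<zeta> \<phi> \<mu> b w =
           nabla ell_family V M P' \<nu>' \<eta> (coord_vf 2) h\<^sub>\<zeta> \<phi> \<mu> b w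
           + conf_weight V M / b $ 2 * \<phi> \<mu> b w"
proof -
  have bU: "b \<in> U" "b \<in> ell_base" using assms(13,19,21) by auto
  then have b2: "b $ 2 \<noteq> 0" by (simp add: ell_base_def)
  have \<eta>: "\<eta> \<in> ell_charts" "(0, b) \<in> cover_dom \<eta>" "fiber_lift \<eta> (0, b) = 0"
    using assms(15) bU by (auto simp: local_coord_def cover_dom_def fiber_lift_def)
  have \<eta>U': "local_coord ell_family U' \<eta>" using assms(15,19) by (auto simp: local_coord_def)
  define x where "x = U_op V M (conf_weight V M) (coord_germ ell_family \<eta> \<mu> b) w"
  \<comment> \<open>Changing the local coordinate transports the block, so both connections act on the same value.\<close>
  have \<phi>x: "\<phi> \<eta> b x = \<phi> \<mu> b w"
  proof -
    have "\<forall>\<mu>. local_coord ell_family U' \<mu> \<longrightarrow> (\<forall>b\<in>U'. \<forall>w\<in>mcar M.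
            \<phi> \<eta> b (U_op V M (conf_weight V M) (coord_germ ell_family \<eta> \<mu> b) w) = \<phi> \<mu> b w)"
      using assms(14,18,19) \<eta>U' unfolding conformal_block_def by meson
    then show ?thesis using assms(20,21,22) unfolding x_def by blast
  qed
  have "cell_chart (\<lambda>(z, b). z) x y \<in> P" for x y by (rule cell_chart_mem[OF assms(7) cell_injective_z])
  then have Z: "cell_chart (\<lambda>(z, b). z) x y \<in> ell_charts" for x y
    using assms(6) by (auto simp: projective_structure_def)
  have sz: "schwarz (\<lambda>z. case (z, b) of (z, b) \<Rightarrow> z) z0 = 0" for z0
    by (simp add: schwarz_def numeral_3_eq_3 numeral_2_eq_2)
  have sexp: "schwarz (\<lambda>z. case (z, b) of (z, b) \<Rightarrow> exp (2 * \<i> * of_real pi * z)) z0 = 2 * of_real pi ^ 2" for z0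
    using schwarz_exp[of "2 * \<i> * of_real pi" z0] by (simp add: power_mult_distrib)
  have S: "0 = schwarzian_ps ell_family \<eta> P (ell_class (z, b)) * (deriv (\<lambda>z. fiber_lift \<eta> (z, b)) z)\<^sup>2
      + schwarz (\<lambda>z. fiber_lift \<eta> (z, b)) z" if "(z, b) \<in> cover_dom \<eta>" for z
    using schwarzian_ps_fiber_lift[OF assms(6,7) cell_injective_z \<eta>(1) that] unfolding sz .
  have S': "2 * of_real pi ^ 2 = schwarzian_ps ell_family \<eta> P' (ell_class (z, b)) * (deriv (\<lambda>z. fiber_lift \<eta> (z, b)) z)\<^sup>2
      + schwarz (\<lambda>z. fiber_lift \<eta> (z, b)) z" if "(z, b) \<in> cover_dom \<eta>" for z
    using schwarzian_ps_fiber_lift[OF assms(8,9) cell_injective_exp \<eta>(1) that] unfolding sexp .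
  have res: "residue (\<lambda>t. ccharge V / 12 * in_chart ell_family \<eta> (h \<eta>) (t, b)
        * in_chart ell_family \<eta> (schwarzian_ps ell_family \<eta> P) (t, b)) 0
     - residue (\<lambda>t. ccharge V / 12 * in_chart ell_family \<eta> (h \<eta>) (t, b)
        * in_chart ell_family \<eta> (schwarzian_ps ell_family \<eta> P') (t, b)) 0
     = (if i = 1 then - (\<i> * ccharge V * of_real pi / 12) else 0)"
    if h: "vf_lift ell_family U (coord_vf i) h" for i h
  proof -
    obtain H where H: "H holomorphic_on - period_lattice (b $ 1)"
      "residue H 0 = - (if i = 1 then 1 else 0) / (2 * of_real pi * \<i>)"
      "\<And>\<kappa> z. \<kappa> \<in> ell_charts \<Longrightarrow> (z, b) \<in> cover_dom \<kappa> \<Longrightarrow> z \<notin> period_lattice (b $ 1) \<Longrightarrow>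
         h \<kappa> (ell_class (z, b)) = H z * deriv (\<lambda>z. fiber_lift \<kappa> (z, b)) z
           + partial i (\<lambda>b. fiber_lift \<kappa> (z, b)) b"
      using assms(13) bU(1) by (auto intro: ell_lift_residue[OF Z h])
    have "residue (\<lambda>t. ccharge V / 12 * in_chart ell_family \<eta> (h \<eta>) (t, b)
        * in_chart ell_family \<eta> (schwarzian_ps ell_family \<eta> P) (t, b)) 0
      - residue (\<lambda>t. ccharge V / 12 * in_chart ell_family \<eta> (h \<eta>) (t, b)
        * in_chart ell_family \<eta> (schwarzian_ps ell_family \<eta> P') (t, b)) 0
      = ccharge V / 12 * (0 - 2 * of_real pi ^ 2) * residue H 0"
      by (rule residue_lift_difference[OF \<eta> H(1) H(3)[OF \<eta>(1)] S S'])
    also have "\<dots> = (if i = 1 then - (\<i> * ccharge V * of_real pi / 12) else 0)"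
      unfolding H(2) by (simp add: field_simps power2_eq_square)
    finally show ?thesis .
  qed
  define d where "d = (\<lambda>i. partial i (\<lambda>b. deriv (\<lambda>z. fiber_lift \<eta> (z, b)) 0) b / deriv (\<lambda>z. fiber_lift \<eta> (z, b)) 0)"
  have log': "log_deriv_jet (coord_vf i) \<nu>' \<eta> b = d i" for i
    unfolding assms(11) d_def by (subst log_deriv_ell_jet[OF \<eta>(1,2)]) (auto simp: partial_def)
  have zeta: "((\<lambda>s. (b + s *s axis i 1) $ 2) has_field_derivative (if i = 2 then 1 else 0)) (at 0)" for i :: 2
    by (auto intro!: derivative_eq_intros simp: axis_def)
  then have "partial i (\<lambda>b. b $ 2) b = (if i = 2 then 1 else 0)" for i
    unfolding partial_def by (rule DERIV_imp_deriv)
  then have log: "log_deriv_jet (coord_vf i) \<nu> \<eta> b = d i - (if i = 2 then 1 else 0) / b $ 2" for i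
    unfolding assms(10) d_def using zeta b2
    by (subst log_deriv_ell_jet[OF \<eta>(1,2)]) (auto simp: field_differentiable_def)
  have nab: "nabla ell_family V M Q \<rho> \<eta> g h \<phi> \<mu> b w = nabla_eta_dual ell_family V M \<eta> g h \<phi> b x
      - residue (\<lambda>t. ccharge V / 12 * in_chart ell_family \<eta> (h \<eta>) (t, b)
                       * in_chart ell_family \<eta> (schwarzian_ps ell_family \<eta> Q) (t, b)) 0 * \<phi> \<mu> b w
      - conf_weight V M * log_deriv_jet g \<rho> \<eta> b * \<phi> \<mu> b w" for Q \<rho> g h
    by (simp add: nabla_def Let_def \<phi>x flip: x_def)
  have key: "nabla ell_family V M P \<nu> \<eta> (coord_vf i) h \<phi> \<mu> b w =
      nabla ell_family V M P' \<nu>' \<eta> (coord_vf i) h \<phi> \<mu> b w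
      + ((if i = 1 then \<i> * ccharge V * of_real pi / 12 else 0)
         + (if i = 2 then conf_weight V M / b $ 2 else 0)) * \<phi> \<mu> b w"
    if h: "vf_lift ell_family U (coord_vf i) h" for i h
  proof -
    define R where "R = residue (\<lambda>t. ccharge V / 12 * in_chart ell_family \<eta> (h \<eta>) (t, b)
        * in_chart ell_family \<eta> (schwarzian_ps ell_family \<eta> P) (t, b)) 0"
    define R' where "R' = residue (\<lambda>t. ccharge V / 12 * in_chart ell_family \<eta> (h \<eta>) (t, b)
        * in_chart ell_family \<eta> (schwarzian_ps ell_family \<eta> P') (t, b)) 0"
    have "R = R' + (if i = 1 then - (\<i> * ccharge V * of_real pi / 12) else 0)"
      using res[OF h] unfolding R_def[symmetric] R'_def[symmetric] by (simp only: diff_eq_eq add.commute)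
    then show ?thesis
      unfolding nab log log' R_def[symmetric] R'_def[symmetric] by (simp add: algebra_simps)
  qed
  show ?thesis using key[OF assms(16)] key[OF assms(17)] by simp
qed

end
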